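(* Let $(V,\|\cdot\|)$ be a finite-dimensional real normed space with dual unit ball $B^\circ\subset V^*$. Every horofunction of $(V,\|\cdot\|)$ is a Busemann point if and only if the set of extreme sets of $B^\circ$ is closed in the Painlevé–Kuratowski topology (on the set of closed subsets of $V^*$).
   Context: $V$ is a finite-dimensional real vector space with norm $\|\cdot\|$ and metric $d(x,y)=\|x-y\|$; $V^*$ is its dual space, with pairing $\langle y|x\rangle$ for $y\in V^*$, $x\in V$. The unit ball is $B=\{x\in V: \|x\|\le 1\}$ and the dual unit ball is $B^\circ=\{y\in V^* : \langle y|x\rangle\ge -1 \text{ for all } x\in B\}$. Extreme sets: a convex subset $E$ of a convex set $C$ is an extreme set of $C$ if, whenever an interior point of a line segment contained in $C$ belongs to $E$, both endpoints of the segment belong to $E$. Extreme sets are understood to be nonempty; $C$ is an extreme set of itself. Painlevé–Kuratowski topology: a sequence of closed sets $(C_n)_{n\in\mathbb N}$ in a finite-dimensional normed space converges to a closed set $C$ if and only if both of the following hold: (i) for each $x\in C$ there exist $x_n\in C_n$, for all $n$ large enough, such that $x_n\to x$; (ii) if $(C_{n_k})_{k\in\mathbb N}$ is a subsequence and $x_k\in C_{n_k}$ for each $k$, then $x_k\to x$ implies $x\in C$. A set of closed sets is closed in this topology if it contains the limit of every convergent sequence of its elements. Horofunctions: for $z\in V$ let $\phi_z(x)=\|z-x\|-\|z\|$, $x\in V$, and let $\mathcal D=\{\phi_z: z\in V\}$. Let $\operatorname{cl}\mathcal D$ be the closure of $\mathcal D$ in the space of continuous real-valued functions on $V$ with the topology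 of uniform convergence on compact sets. The horofunction boundary of $V$ is $(\operatorname{cl}\mathcal D)\setminus\mathcal D$, and its elements are called horofunctions (thus horofunctions are normalised to take the value $0$ at the origin). Busemann points: an almost-geodesic is a map $\gamma:T\to V$, where $T\subset[0,\infty)$ is an unbounded set containing $0$, such that for every $\epsilon>0$, $|d(\gamma(t),\gamma(s))+d(\gamma(s),\gamma(0))-t|<\epsilon$ for all sufficiently large $s,t\in T$ with $t\ge s$. A Busemann point is a horofunction $h$ for which there is an almost-geodesic $\gamma$ such that $\phi_{\gamma(t)}\to h$ uniformly on compact sets as $t\to\infty$ in $T$. *)

theory Defs
  imports "HOL-Analysis.Analysis"
begin

text \<open>
  The dual space of \<open>V = 'a\<close> is the type \<open>'a \<Rightarrow>\<^sub>L real\<close> of bounded linear functionals with the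
  operator norm; if \<open>'a\<close> is finite-dimensional, every linear functional on it is bounded.
\<close>

definition dual_unit_ball :: "('a::real_normed_vector \<Rightarrow>\<^sub>L real) set" where
  "dual_unit_ball = {y. \<forall>x\<in>cball 0 1. blinfun_apply y x \<ge> -1}"

definition extreme_sets :: "'b::real_vector set \<Rightarrow> 'b set set" where
  "extreme_sets C = {E. E face_of C \<and> E \<noteq> {}}"


definition PK_converges :: "(nat \<Rightarrow> 'b::topological_space set) \<Rightarrow> 'b set \<Rightarrow> bool" where
  "PK_converges F C \<longleftrightarrow>
     (\<forall>x\<in>C. \<exists>X. (\<forall>\<^sub>F n in sequentially. X n \<in> F n) \<and> X \<longlonglongrightarrow> x) \<and>
     (\<forall>r X x. strict_mono (r :: nat \<Rightarrow> nat) \<and> (\<forall>k. X k \<in> F (r k)) \<and> X \<longlonglongrightarrow> x \<longrightarrow> x \<in> C)"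

text \<open>
  As for \<^const>\<open>closedin\<close>, a closed set of the topology is required to be a subset of the
  underlying space, which here consists of all closed subsets.
\<close>

definition PK_closed :: "'b::topological_space set set \<Rightarrow> bool" where
  "PK_closed S \<longleftrightarrow> S \<subseteq> Collect closed \<and>
     (\<forall>F C. (\<forall>n. F n \<in> S) \<and> closed C \<and> PK_converges F C \<longrightarrow> C \<in> S)"


text \<open>
  The space of continuous real-valued functions with the topology of uniform convergence on
  compact sets: the sets \<open>ucc_nbhd f K e\<close> with \<open>K\<close> compact and \<open>e > 0\<close> form a
  neighbourhood base at \<open>f\<close>.
\<close>

definition ucc_nbhd :: "('a::topological_space \<Rightarrow> real) \<Rightarrow> 'a set \<Rightarrow> real \<Rightarrow> ('a \<Rightarrow> real) set" where
  "ucc_nbhd f K e = {g. continuous_on UNIV g \<and> (\<forall>x\<in>K. \<bar>g x - f x\<bar> < e)}"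

definition ucc_open :: "('a::topological_space \<Rightarrow> real) set \<Rightarrow> bool" where
  "ucc_open U \<longleftrightarrow> U \<subseteq> {f. continuous_on UNIV f} \<and>
     (\<forall>f\<in>U. \<exists>K e. compact K \<and> e > 0 \<and> ucc_nbhd f K e \<subseteq> U)"

definition ucc_topology :: "('a::topological_space \<Rightarrow> real) topology" where
  "ucc_topology = topology ucc_open"

lemma istopology_ucc_open: "istopology ucc_open"
  unfolding istopology_def
proof (intro conjI allI impI)
  fix S T :: "('a \<Rightarrow> real) set"
  assume S: "ucc_open S" and T: "ucc_open T"
  have "\<exists>K e. compact K \<and> e > 0 \<and> ucc_nbhd f K e \<subseteq> S \<inter> T" if f: "f \<in> S \<inter> T" for f
  proof -
    obtain K e where 1: "compact K" "e > 0" "ucc_nbhd f K e \<subseteq> S"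
      using S f unfolding ucc_open_def by blast
    obtain L d where 2: "compact L" "d > 0" "ucc_nbhd f L d \<subseteq> T"
      using T f unfolding ucc_open_def by blast
    have "ucc_nbhd f (K \<union> L) (min e d) \<subseteq> S \<inter> T"
      using 1(3) 2(3) unfolding ucc_nbhd_def by auto
    moreover have "compact (K \<union> L)" "min e d > 0"
      using 1 2 by (auto intro: compact_Un)
    ultimately show ?thesis by blast
  qed
  then show "ucc_open (S \<inter> T)"
    using S unfolding ucc_open_def by blast
next
  fix \<K> :: "('a \<Rightarrow> real) set set"
  assume "\<forall>K\<in>\<K>. ucc_open K"
  then show "ucc_open (\<Union>\<K>)"
    unfolding ucc_open_def by (meson Union_iff Union_least Union_upper subset_trans)
qed

lemma openin_ucc_topology: "openin ucc_topology U \<longleftrightarrow> ucc_open U"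
  unfolding ucc_topology_def by (simp add: istopology_ucc_open topology_inverse')

lemma topspace_ucc_topology: "topspace ucc_topology = {f. continuous_on UNIV f}"
proof -
  have "ucc_open {f :: 'a \<Rightarrow> real. continuous_on UNIV f}"
    unfolding ucc_open_def ucc_nbhd_def
    by (auto intro!: exI[of _ "{}"] exI[of _ "1::real"])
  then show ?thesis
    unfolding topspace_def openin_ucc_topology by (auto simp: ucc_open_def)
qed


definition dist_fun :: "'a::real_normed_vector \<Rightarrow> 'a \<Rightarrow> real" where
  "dist_fun z = (\<lambda>x. norm (z - x) - norm z)"

definition horofunction_boundary :: "('a::real_normed_vector \<Rightarrow> real) set" where
  "horofunction_boundary = (ucc_topology closure_of range dist_fun) - range dist_fun"

text \<open>Only the values of \<open>\<gamma>\<close> on \<open>T\<close> matter.\<close>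

definition almost_geodesic :: "real set \<Rightarrow> (real \<Rightarrow> 'a::real_normed_vector) \<Rightarrow> bool" where
  "almost_geodesic T \<gamma> \<longleftrightarrow> T \<subseteq> {0..} \<and> \<not> bounded T \<and> 0 \<in> T \<and>
     (\<forall>\<epsilon>>0. \<exists>N. \<forall>s\<in>T. \<forall>t\<in>T. N \<le> s \<and> s \<le> t \<longrightarrow>
        \<bar>dist (\<gamma> t) (\<gamma> s) + dist (\<gamma> s) (\<gamma> 0) - t\<bar> < \<epsilon>)"

text \<open>The filter \<open>inf at_top (principal T)\<close> expresses \<open>t \<rightarrow> \<infinity>\<close> within \<open>T\<close>.\<close>

definition busemann_point :: "('a::real_normed_vector \<Rightarrow> real) \<Rightarrow> bool" where
  "busemann_point h \<longleftrightarrow> h \<in> horofunction_boundary \<and>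
     (\<exists>T \<gamma>. almost_geodesic T \<gamma> \<and>
        (\<forall>K. compact K \<longrightarrow>
           uniform_limit K (\<lambda>t. dist_fun (\<gamma> t)) h (inf at_top (principal T))))"

end

theory Submission
  imports Defs "HOL-Complex_Analysis.Great_Picard"
begin

text \<open>
  Let \<open>D\<close> be the dual unit ball. As the norm is the support function of \<open>D\<close>, the normalised distance
  function of a point \<open>z\<close> is the convex conjugate of the affine function on \<open>D\<close> with slope \<open>z\<close> and
  minimum \<open>0\<close>, extended by \<open>\<infinity>\<close>. So limits of distance functions correspond to epigraphical limits of
  such affine functions, and the question is which limits occur.

  The good limits are those that are affine on a face \<open>E\<close> of \<open>D\<close> and infinite elsewhere; their
  conjugates are the functions \<open>support_dist_fun E p\<close>. Unless it is a distance function itself, such a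
  conjugate is the limit of distance functions along an almost-geodesic (\<open>face_support_dist_fun_limit\<close>), because every face, exposed or not, is exposed up to an arbitrarily
  small error (\<open>face_nearly_exposed\<close>). Conversely, if the support function of a convex set
  \<open>C \<subseteq> D\<close> is the limit along an almost-geodesic, then \<open>C\<close> consists of the points of \<open>D\<close> where a
  sequence of nonnegative affine functions stays bounded, and is therefore a face
  (\<open>face_if_support_fun_limit\<close>).

  If all horofunctions are Busemann points and faces \<open>E n\<close> converge to \<open>C\<close>, almost exposing
  functionals of the \<open>E n\<close> have distance functions that converge to the support function of \<open>C\<close>. This
  limit is a distance function or a Busemann point, so \<open>C\<close> is a face.

  If the set of faces is closed, let \<open>h\<close> be a limit of distance functions and \<open>y\<close> a relatively interior
  point of the domain of its conjugate. Among all faces that carry points near \<open>y\<close> at which the affine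
  functions nearly have the limiting value, those of least dimension contain such points at a
  uniform depth (\<open>deep_recovery_points\<close>); otherwise their relative boundaries, which consist of smaller
  faces, would do as well. Since the affine functions are nonnegative, their slopes along
  these faces are bounded, so a subsequence of the faces and of the slopes converges. The limit of the
  faces is a face \<open>F\<close> with \<open>y\<close> in it, hence contains the domain of the conjugate, and the conjugate is
  affine on \<open>F\<close> (\<open>limit_eq_support_dist_fun\<close>). So \<open>h\<close> is a distance function or a Busemann point.

  The convex geometry takes place in Euclidean spaces. A finite-dimensional space \<open>'a\<close> is reached
  through coordinates with respect to a finite spanning set, which is made into an index type.
\<close>

section \<open>Support functions\<close>

definition support_fun :: "'b::real_inner set \<Rightarrow> 'b \<Rightarrow> real" where
  "support_fun C x = (SUP y\<in>C. y \<bullet> x)"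

text \<open>For the dual unit ball \<open>C\<close> this is the normalised distance function of the point \<open>z\<close>; for a
  face \<open>C\<close> of the dual unit ball it is the limit of distance functions that belongs to \<open>C\<close> and \<open>z\<close>.\<close>
definition support_dist_fun :: "'b::real_inner set \<Rightarrow> 'b \<Rightarrow> 'b \<Rightarrow> real" where
  "support_dist_fun C z x = support_fun C (x - z) - support_fun C (- z)"

lemma support_fun_attained:
  assumes "compact C" "C \<noteq> {}"
  obtains y where "y \<in> C" "support_fun C x = y \<bullet> x" "\<And>w. w \<in> C \<Longrightarrow> w \<bullet> x \<le> y \<bullet> x"
proof -
  have "continuous_on C (\<lambda>y. y \<bullet> x)" by (intro continuous_intros)
  from continuous_attains_sup[OF assms this]
  obtain y where y: "y \<in> C" "\<forall>w\<in>C. w \<bullet> x \<le> y \<bullet> x" by blast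
  then have "support_fun C x = y \<bullet> x"
    unfolding support_fun_def by (intro cSup_eq_maximum) auto
  with y that show thesis by blast
qed

lemma support_fun_upper:
  assumes "compact C" "y \<in> C"
  shows "y \<bullet> x \<le> support_fun C x"
  using assms by (metis empty_iff support_fun_attained)

lemma support_fun_le:
  assumes "compact C" "C \<noteq> {}" "\<And>y. y \<in> C \<Longrightarrow> y \<bullet> x \<le> b"
  shows "support_fun C x \<le> b"
  using assms by (metis support_fun_attained)

lemma support_fun_zero:
  assumes "compact C" "C \<noteq> {}"
  shows "support_fun C 0 = 0"
  using assms by (metis inner_zero_right support_fun_attained)

lemma support_fun_scaleR:
  assumes "compact C" "C \<noteq> {}" "t \<ge> 0"
  shows "support_fun C (t *\<^sub>R x) = t * support_fun C x"
proof (rule antisym)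
  show "support_fun C (t *\<^sub>R x) \<le> t * support_fun C x"
    by (rule support_fun_le)
      (use assms support_fun_upper in \<open>auto intro!: mult_left_mono\<close>)
  obtain y where "y \<in> C" "support_fun C x = y \<bullet> x"
    using support_fun_attained assms by metis
  then show "t * support_fun C x \<le> support_fun C (t *\<^sub>R x)"
    using support_fun_upper[OF assms(1), of y "t *\<^sub>R x"] by simp
qed

lemma support_fun_lipschitz:
  assumes "compact C" "C \<noteq> {}" "\<And>y. y \<in> C \<Longrightarrow> norm y \<le> R"
  shows "\<bar>support_fun C x - support_fun C x'\<bar> \<le> R * norm (x - x')"
proof -
  have "support_fun C x \<le> support_fun C x' + R * norm (x - x')" for x x'
  proof (rule support_fun_le[OF assms(1,2)])
    fix y assume y: "y \<in> C"
    have "y \<bullet> (x - x') \<le> norm y * norm (x - x')"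
      by (rule norm_cauchy_schwarz)
    also have "\<dots> \<le> R * norm (x - x')"
      using assms(3)[OF y] by (simp add: mult_right_mono)
    finally show "y \<bullet> x \<le> support_fun C x' + R * norm (x - x')"
      using support_fun_upper[OF assms(1) y, of x'] by (simp add: inner_diff_right)
  qed
  from this[of x x'] this[of x' x] show ?thesis
    by (simp add: norm_minus_commute)
qed

lemma support_dist_fun_zero: "support_dist_fun C z 0 = 0"
  by (simp add: support_dist_fun_def)

text \<open>\<open>y \<mapsto> y \<bullet> z + support_fun D (- z)\<close> is the affine function with slope \<open>z\<close>
  and minimum \<open>0\<close> on \<open>D\<close>; this is Fenchel's inequality for it, and equality occurs by the next lemma.\<close>
lemma support_dist_fun_ge:
  assumes "compact D" "y \<in> D"
  shows "y \<bullet> x - (y \<bullet> z + support_fun D (- z)) \<le> support_dist_fun D z x"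
  using support_fun_upper[OF assms, of "x - z"]
  by (simp add: support_dist_fun_def inner_diff_right)

lemma support_dist_fun_attained:
  assumes "compact D" "D \<noteq> {}"
  obtains y where "y \<in> D" "support_dist_fun D z x = y \<bullet> x - (y \<bullet> z + support_fun D (- z))"
proof -
  obtain y where "y \<in> D" "support_fun D (x - z) = y \<bullet> (x - z)"
    using support_fun_attained[OF assms] by metis
  then show thesis
    by (intro that[of y]) (auto simp: support_dist_fun_def inner_diff_right)
qed

lemma support_dist_fun_lipschitz:
  assumes "compact C" "C \<noteq> {}" "\<And>y. y \<in> C \<Longrightarrow> norm y \<le> R"
  shows "\<bar>support_dist_fun C z x - support_dist_fun C z x'\<bar> \<le> R * dist x x'"
  using support_fun_lipschitz[OF assms, of "x - z" "x' - z"]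
  by (simp add: support_dist_fun_def dist_norm)

section \<open>Painleve-Kuratowski limits\<close>

lemma frequently_sequentially_subseq:
  assumes "\<And>k. \<exists>\<^sub>F n in sequentially. P k n"
  obtains r where "strict_mono (r :: nat \<Rightarrow> nat)" "\<And>k. P k (r k)"
proof -
  have ex: "\<exists>n>m. P k n" for k m
    using assms[of k] by (auto simp: frequently_sequentially) (meson Suc_le_lessD)
  have "\<exists>r. \<forall>k. P k (r k) \<and> r k < r (Suc k)"
    by (rule dependent_nat_choice) (use ex in \<open>blast+\<close>)
  then show thesis using that by (auto simp: strict_mono_Suc_iff)
qed

lemma PK_limit_subseq_mem:
  assumes "PK_converges F C" "strict_mono r" "\<And>k. X k \<in> F (r k)" "X \<longlonglongrightarrow> x"
  shows "x \<in> C"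
  using assms unfolding PK_converges_def by blast

lemma PK_limit_mem:
  assumes PK: "PK_converges F C" and X: "\<forall>\<^sub>F n in sequentially. X n \<in> F n" "X \<longlonglongrightarrow> x"
  shows "x \<in> C"
proof -
  obtain N where N: "\<And>n. n \<ge> N \<Longrightarrow> X n \<in> F n"
    using X(1) by (auto simp: eventually_sequentially)
  have "strict_mono (\<lambda>k. k + N)" by (simp add: strict_mono_def)
  moreover have "\<forall>k. X (k + N) \<in> F (k + N)" using N by simp
  moreover have "(\<lambda>k. X (k + N)) \<longlonglongrightarrow> x" using X(2) by (rule LIMSEQ_ignore_initial_segment)
  ultimately show ?thesis
    using PK unfolding PK_converges_def by (metis (no_types, lifting))
qed

lemma PK_limit_approx:
  assumes "PK_converges F C" "x \<in> C"
  obtains X where "\<forall>\<^sub>F n in sequentially. X n \<in> F n" "X \<longlonglongrightarrow> x"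
  using assms unfolding PK_converges_def by blast

lemma PK_limit_convex:
  fixes C :: "'b::real_normed_vector set"
  assumes PK: "PK_converges F C" and "\<And>n. convex (F n)"
  shows "convex C"
proof (rule convexI)
  fix x y and u v :: real
  assume xy: "x \<in> C" "y \<in> C" and uv: "0 \<le> u" "0 \<le> v" "u + v = 1"
  obtain X where X: "\<forall>\<^sub>F n in sequentially. X n \<in> F n" "X \<longlonglongrightarrow> x"
    using PK xy(1) by (rule PK_limit_approx)
  obtain Y where Y: "\<forall>\<^sub>F n in sequentially. Y n \<in> F n" "Y \<longlonglongrightarrow> y"
    using PK xy(2) by (rule PK_limit_approx)
  have "\<forall>\<^sub>F n in sequentially. u *\<^sub>R X n + v *\<^sub>R Y n \<in> F n"
    using X(1) Y(1) by eventually_elim (use assms(2) uv in \<open>auto simp: convex_def\<close>)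
  moreover have "(\<lambda>n. u *\<^sub>R X n + v *\<^sub>R Y n) \<longlonglongrightarrow> u *\<^sub>R x + v *\<^sub>R y"
    by (intro tendsto_intros X Y)
  ultimately show "u *\<^sub>R x + v *\<^sub>R y \<in> C" by (rule PK_limit_mem[OF PK])
qed

lemma PK_limit_subset:
  assumes PK: "PK_converges F C" and "\<And>n. F n \<subseteq> D" "closed (D :: 'b::metric_space set)"
  shows "C \<subseteq> D"
proof
  fix x assume "x \<in> C"
  then obtain X where X: "\<forall>\<^sub>F n in sequentially. X n \<in> F n" "X \<longlonglongrightarrow> x"
    using PK by (metis PK_limit_approx)
  have "\<forall>\<^sub>F n in sequentially. X n \<in> D"
    using X(1) by eventually_elim (use assms(2) in blast)
  then show "x \<in> D"
    using Lim_in_closed_set[OF assms(3) _ _ X(2)] by simp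
qed

lemma PK_limit_nonempty:
  assumes PK: "PK_converges F C" and "\<And>n. F n \<subseteq> D" "\<And>n. F n \<noteq> {}" "compact (D :: 'b::metric_space set)"
  shows "C \<noteq> {}"
proof -
  have "\<forall>n. \<exists>x. x \<in> F n" using assms(3) by blast
  then obtain X where X: "\<And>n. X n \<in> F n" by metis
  then have "\<forall>n. X n \<in> D" using assms(2) by blast
  then obtain l r where "l \<in> D" "strict_mono (r :: nat \<Rightarrow> nat)" "(X \<circ> r) \<longlonglongrightarrow> l"
    using assms(4) unfolding compact_def by blast
  moreover have "\<forall>k. (X \<circ> r) k \<in> F (r k)" using X by simp
  ultimately show ?thesis
    using PK unfolding PK_converges_def by blast
qed

lemma PK_closedD:
  assumes "PK_closed S" "\<And>n. F n \<in> S" "closed C" "PK_converges F C"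
  shows "C \<in> S"
  using assms unfolding PK_closed_def by blast

text \<open>Compactness of the space of nonempty closed subsets of a compact set: the functions
  \<open>infdist _ (F n)\<close> are \<open>1\<close>-Lipschitz, so a subsequence of them converges uniformly, and
  the zero set of the limit is the limit of the sets.\<close>
lemma PK_convergent_subsequence:
  fixes F :: "nat \<Rightarrow> 'b::euclidean_space set"
  assumes D: "compact D" and F: "\<And>n. F n \<subseteq> D" "\<And>n. F n \<noteq> {}" "\<And>n. closed (F n)"
  obtains r C where "strict_mono (r :: nat \<Rightarrow> nat)" "closed C" "PK_converges (F \<circ> r) C"
proof -
  obtain R where R: "\<And>y. y \<in> D \<Longrightarrow> norm y \<le> R"
    using compact_imp_bounded[OF D] unfolding bounded_iff by blast
  have bound: "norm (infdist x (F n)) \<le> 2 * R" if "x \<in> D" for n x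
  proof -
    obtain y where y: "y \<in> F n" using F(2) by blast
    have "infdist x (F n) \<le> dist x y" by (rule infdist_le[OF y])
    also have "\<dots> \<le> norm x + norm y" by (metis dist_norm norm_triangle_ineq4)
    finally show ?thesis using R[OF that] R[of y] y F(1)[of n] infdist_nonneg[of x "F n"]
      by auto
  qed
  have equi: "\<exists>d>0. \<forall>n y. y \<in> D \<and> norm (x - y) < d \<longrightarrow> norm (infdist x (F n) - infdist y (F n)) < e"
    if "e > 0" for x e
  proof (intro exI[of _ e] conjI allI impI)
    fix n y assume "y \<in> D \<and> norm (x - y) < e"
    then show "norm (infdist x (F n) - infdist y (F n)) < e"
      using infdist_triangle_abs[of x "F n" y] by (simp add: dist_norm)
  qed (use that in simp)
  obtain g r where g: "continuous_on D g" "strict_mono (r :: nat \<Rightarrow> nat)"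
    "\<And>e. 0 < e \<Longrightarrow> \<exists>N. \<forall>n x. n \<ge> N \<and> x \<in> D \<longrightarrow> norm (infdist x (F (r n)) - g x) < e"
    using Arzela_Ascoli[of D "\<lambda>n x. infdist x (F n)" "2 * R", OF D bound equi] by metis
  define C where "C = {x\<in>D. g x = 0}"
  have clC: "closed C"
    unfolding C_def using g(1) D compact_imp_closed
    by (intro continuous_closed_preimage_constant) auto
  have ptw: "(\<lambda>n. infdist x (F (r n))) \<longlonglongrightarrow> g x" if "x \<in> D" for x
    using g(3) that unfolding LIMSEQ_iff by blast
  have "PK_converges (F \<circ> r) C"
    unfolding PK_converges_def
  proof (intro conjI ballI allI impI)
    fix x assume x: "x \<in> C"
    have "\<exists>y\<in>F (r n). infdist x (F (r n)) = dist x y" for n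
      using infdist_attains_inf[OF F(3) F(2)] by metis
    then obtain X where X: "\<And>n. X n \<in> F (r n)" "\<And>n. infdist x (F (r n)) = dist x (X n)"
      by metis
    have "(\<lambda>n. dist x (X n)) \<longlonglongrightarrow> 0"
      using ptw[of x] x X(2) by (simp add: C_def)
    then have "X \<longlonglongrightarrow> x"
      by (subst tendsto_dist_iff) (simp add: dist_commute)
    with X(1) show "\<exists>X. (\<forall>\<^sub>F n in sequentially. X n \<in> (F \<circ> r) n) \<and> X \<longlonglongrightarrow> x"
      by (intro exI[of _ X]) auto
  next
    fix q :: "nat \<Rightarrow> nat" and X x
    assume *: "strict_mono q \<and> (\<forall>k. X k \<in> (F \<circ> r) (q k)) \<and> X \<longlonglongrightarrow> x"
    have "\<And>k. X k \<in> D" using * F(1) by auto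
    then have xD: "x \<in> D"
      using * closed_sequentially[OF compact_imp_closed[OF D]] by blast
    have "(\<lambda>k. infdist x (F (r (q k)))) \<longlonglongrightarrow> g x"
      using LIMSEQ_subseq_LIMSEQ[OF ptw[OF xD], of q] * by (simp add: o_def)
    moreover have "(\<lambda>k. infdist x (F (r (q k)))) \<longlonglongrightarrow> 0"
    proof (rule tendsto_sandwich[of "\<lambda>_. 0" _ _ "\<lambda>k. dist x (X k)"])
      show "(\<lambda>k. dist x (X k)) \<longlonglongrightarrow> 0"
        using * tendsto_dist[of "\<lambda>_. x" x sequentially X x] by simp
      show "\<forall>\<^sub>F k in sequentially. infdist x (F (r (q k))) \<le> dist x (X k)"
      proof (rule always_eventually, rule allI)
        fix k
        show "infdist x (F (r (q k))) \<le> dist x (X k)" by (rule infdist_le) (use * in simp)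
      qed
    qed (auto simp: infdist_nonneg)
    ultimately have "g x = 0" using LIMSEQ_unique by blast
    then show "x \<in> C" using xD by (simp add: C_def)
  qed
  with clC g(2) that show thesis by blast
qed

section \<open>Almost exposing functionals of faces\<close>

text \<open>A face \<open>E\<close> need not be exposed, so there may be no functional that is minimal on \<open>D\<close> exactly
  along \<open>E\<close>. Up to \<open>\<epsilon>\<close> there is one: a point over \<open>E\<close> in the convex hull of \<open>D \<times> {0}\<close> and
  \<open>{y\<in>D. \<epsilon> \<le> infdist y E} \<times> {M}\<close> has height \<open>0\<close>, because a convex combination of points of
  \<open>D\<close> with positive weights lies in \<open>E\<close> only if the points do. So a hyperplane separates this hull
  from \<open>E \<times> {\<epsilon>..}\<close>, and it is the graph of an affine function.\<close>
lemma face_nearly_exposed: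
  fixes D :: "'b::euclidean_space set"
  assumes D: "compact D" "convex D" and E: "E face_of D" "E \<noteq> {}" and "\<epsilon> > 0"
  obtains w c where "\<And>y. y \<in> D \<Longrightarrow> c \<le> y \<bullet> w" "\<And>y. y \<in> E \<Longrightarrow> y \<bullet> w \<le> c + \<epsilon>"
    "\<And>y. y \<in> D \<Longrightarrow> \<epsilon> \<le> infdist y E \<Longrightarrow> c + M \<le> y \<bullet> w"
proof -
  define S where "S = D \<times> {0} \<union> (D \<inter> {y. \<epsilon> \<le> infdist y E}) \<times> {M :: real}"
  define Z where "Z = {p :: 'b \<times> real. fst p \<in> D \<and> (fst p \<in> E \<longrightarrow> snd p = 0)}"
  define Q where "Q = E \<times> {\<epsilon>..}"
  have cmpE: "compact E" using face_of_imp_compact D E by blast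
  have sub: "E \<subseteq> D" using E face_of_imp_subset by blast
  have "closed {y. \<epsilon> \<le> infdist y E}"
    by (intro closed_Collect_le continuous_intros)
  then have "compact S"
    unfolding S_def using D by (intro compact_Un compact_Times compact_Int_closed) auto
  then have cS: "compact (convex hull S)" by (rule compact_convex_hull)
  have "convex Z"
  proof (rule convexI)
    fix p q :: "'b \<times> real" and u v :: real
    assume pq: "p \<in> Z" "q \<in> Z" and uv: "0 \<le> u" "0 \<le> v" "u + v = 1"
    have inD: "u *\<^sub>R fst p + v *\<^sub>R fst q \<in> D"
      using pq uv D(2) by (auto simp: Z_def convex_def)
    have "u * snd p + v * snd q = 0" if mem: "u *\<^sub>R fst p + v *\<^sub>R fst q \<in> E"
    proof (cases "u = 0 \<or> v = 0 \<or> fst p = fst q")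
      case True
      moreover have "fst q \<in> E" if "fst p = fst q"
        using mem that uv by (metis scaleR_add_left scaleR_one)
      ultimately show ?thesis using pq uv mem by (auto simp: Z_def)
    next
      case False
      then have "u *\<^sub>R fst p + v *\<^sub>R fst q \<in> open_segment (fst p) (fst q)"
        using uv by (auto simp: in_segment intro!: exI[of _ v])
      then have "fst p \<in> E \<and> fst q \<in> E"
        using E(1) mem pq unfolding face_of_def Z_def by auto
      then show ?thesis using pq by (auto simp: Z_def)
    qed
    with inD show "u *\<^sub>R p + v *\<^sub>R q \<in> Z" by (simp add: Z_def)
  qed
  moreover have "S \<subseteq> Z"
    using \<open>\<epsilon> > 0\<close> by (auto simp: S_def Z_def)
  ultimately have hull: "convex hull S \<subseteq> Z" by (simp add: hull_minimal)
  have "convex hull S \<inter> Q = {}"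
    using hull \<open>\<epsilon> > 0\<close> by (fastforce simp: Z_def Q_def)
  moreover have "convex Q" "closed Q"
    unfolding Q_def using E(1) face_of_imp_convex compact_imp_closed[OF cmpE]
    by (auto intro!: convex_Times closed_Times)
  moreover have "convex hull S \<noteq> {}" using E(2) sub by (auto simp: S_def)
  ultimately obtain a b where ab: "\<forall>p\<in>convex hull S. a \<bullet> p < b" "\<forall>p\<in>Q. b < a \<bullet> p"
    using separating_hyperplane_compact_closed[of "convex hull S" Q] cS convex_convex_hull by metis
  \<comment> \<open>The hyperplane is not vertical: it passes above \<open>(y, 0)\<close> and below \<open>(y, \<epsilon>)\<close> for \<open>y \<in> E\<close>.\<close>
  define \<beta> where "\<beta> = snd a"
  have below: "fst a \<bullet> y + \<beta> * s < b" if "(y, s) \<in> S" for y s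
    using bspec[OF ab(1) hull_inc[OF that]] by (simp add: \<beta>_def inner_prod_def)
  have above: "b < fst a \<bullet> y + \<beta> * \<epsilon>" if "y \<in> E" for y
    using ab(2) that by (auto simp: \<beta>_def inner_prod_def Q_def)
  have low: "fst a \<bullet> y < b" if "y \<in> D" for y
    using below[of y 0] that by (simp add: S_def)
  have "\<beta> * \<epsilon> > 0"
    using E(2) low above sub by (metis add_le_same_cancel1 ex_in_conv less_trans not_le subsetD linorder_not_less)
  then have pos: "\<beta> > 0" using \<open>\<epsilon> > 0\<close> by (simp add: zero_less_mult_iff)
  have eq: "y \<bullet> (- (1 / \<beta>) *\<^sub>R fst a) = - (fst a \<bullet> y) / \<beta>" for y
    by (simp add: inner_commute)
  show thesis
  proof (rule that[of "- b / \<beta>" "- (1 / \<beta>) *\<^sub>R fst a"])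
    show "- b / \<beta> \<le> y \<bullet> (- (1 / \<beta>) *\<^sub>R fst a)" if "y \<in> D" for y
      unfolding eq using low[OF that] pos by (simp add: divide_right_mono)
    show "y \<bullet> (- (1 / \<beta>) *\<^sub>R fst a) \<le> - b / \<beta> + \<epsilon>" if "y \<in> E" for y
      unfolding eq using above[OF that] pos by (simp add: field_simps)
    show "- b / \<beta> + M \<le> y \<bullet> (- (1 / \<beta>) *\<^sub>R fst a)" if "y \<in> D" "\<epsilon> \<le> infdist y E" for y
    proof -
      have "(fst a \<bullet> y + \<beta> * M) / \<beta> \<le> b / \<beta>"
        using below[of y M] that pos by (intro divide_right_mono) (auto simp: S_def)
      then show ?thesis unfolding eq using pos by (simp add: add_divide_distrib)
    qed
  qed
qed

text \<open>If \<open>w n\<close> is almost exposing for \<open>E n\<close> in the sense of \<open>face_nearly_exposed\<close>, then the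
  affine functions \<open>y \<mapsto> y \<bullet> w n - c n\<close> epi-converge on \<open>D\<close> to the indicator function of the
  limit of the sets \<open>E n\<close>; the conclusion is the corresponding convergence of conjugates.\<close>
lemma support_fun_nearly_exposing_limit:
  fixes D :: "'b::euclidean_space set"
  assumes D: "compact D" and sub: "\<And>n. E n \<subseteq> D" and E: "\<And>n. E n \<noteq> {}" "\<And>n. closed (E n)"
    and PK: "PK_converges E C" and C: "closed C"
    and low: "\<And>n y. y \<in> D \<Longrightarrow> c n \<le> y \<bullet> w n"
    and up: "\<And>n y. y \<in> E n \<Longrightarrow> y \<bullet> w n \<le> c n + 1 / real (Suc n)"
    and far: "\<And>n y. y \<in> D \<Longrightarrow> 1 / real (Suc n) \<le> infdist y (E n) \<Longrightarrow> c n + real n \<le> y \<bullet> w n"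
  shows "(\<lambda>n. support_fun D (q - w n) + c n) \<longlonglongrightarrow> support_fun C q"
proof (rule order_tendstoI)
  define s where "s n = support_fun D (q - w n) + c n" for n
  have inv: "(\<lambda>n. 1 / real (Suc n)) \<longlonglongrightarrow> 0"
    using LIMSEQ_inverse_real_of_nat by (simp add: inverse_eq_divide)
  have Cn: "C \<noteq> {}" using PK_limit_nonempty[OF PK sub E(1) D] .
  have CD: "C \<subseteq> D" using PK_limit_subset[OF PK sub compact_imp_closed[OF D]] .
  have cmpC: "compact C" using C CD D compact_Int_closed[OF D C] by (simp add: Int_absorb1)
  have Dn: "D \<noteq> {}" using CD Cn by blast
  obtain y where y: "y \<in> C" "support_fun C q = y \<bullet> q"
    using support_fun_attained[OF cmpC Cn] by metis
  obtain X where X: "\<forall>\<^sub>F n in sequentially. X n \<in> E n" "X \<longlonglongrightarrow> y"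
    using PK y(1) by (rule PK_limit_approx)
  {
    fix a assume a: "a < support_fun C q"
    have "(\<lambda>n. X n \<bullet> q - 1 / real (Suc n)) \<longlonglongrightarrow> y \<bullet> q - 0"
      by (intro tendsto_intros X inv)
    then have "\<forall>\<^sub>F n in sequentially. a < X n \<bullet> q - 1 / real (Suc n)"
      using a y(2) by (intro order_tendstoD) auto
    then show "\<forall>\<^sub>F n in sequentially. a < support_fun D (q - w n) + c n"
      using X(1)
    proof eventually_elim
      case (elim n)
      then have "X n \<in> D" using sub by blast
      from support_fun_upper[OF D this, of "q - w n"] up[OF elim(2)] elim(1)
      show ?case by (simp add: inner_diff_right)
    qed
  }
  {
    fix a assume a: "a > support_fun C q"
    show "\<forall>\<^sub>F n in sequentially. support_fun D (q - w n) + c n < a"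
    proof (rule ccontr)
      assume "\<not> ?thesis"
      then have "\<exists>\<^sub>F n in sequentially. a \<le> s n"
        by (simp add: not_eventually not_less s_def)
      then obtain r where r: "strict_mono (r :: nat \<Rightarrow> nat)" "\<And>k. a \<le> s (r k)"
        using frequently_sequentially_subseq[of "\<lambda>_ n. a \<le> s n"] by metis
      have "\<exists>v\<in>D. s (r k) = v \<bullet> q - (v \<bullet> w (r k) - c (r k))" for k
        using support_fun_attained[OF D Dn, of "q - w (r k)"]
        by (auto simp: s_def inner_diff_right)
      then obtain v where v: "\<And>k. v k \<in> D" "\<And>k. s (r k) = v k \<bullet> q - (v k \<bullet> w (r k) - c (r k))"
        by metis
      have vq: "a \<le> v k \<bullet> q" for k
        using low[OF v(1), of "r k" k] v(2)[of k] r(2)[of k] by linarith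
      have "\<exists>v'\<in>E (r k). infdist (v k) (E (r k)) = dist (v k) v'" for k
        using infdist_attains_inf[OF E(2) E(1)] by metis
      then obtain v' where v': "\<And>k. v' k \<in> E (r k)" "\<And>k. infdist (v k) (E (r k)) = dist (v k) (v' k)"
        by metis
      \<comment> \<open>Maximisers \<open>v k\<close> far from the faces would pay the penalty \<open>r k\<close>, so they accumulate in \<open>C\<close>.\<close>
      obtain l p where l: "l \<in> D" "strict_mono (p :: nat \<Rightarrow> nat)" "(v \<circ> p) \<longlonglongrightarrow> l"
        using D v(1) unfolding compact_def by blast
      obtain N :: nat where N: "real N > support_fun D q - a" using reals_Archimedean2 by blast
      have near: "dist (v k) (v' k) \<le> 1 / real (Suc k)" if "k \<ge> N" for k
      proof -
        have "real N \<le> real (r k)"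
          using that seq_suble[OF r(1), of k] by linarith
        moreover have "v k \<bullet> w (r k) - c (r k) \<le> support_fun D q - a"
          using v(2)[of k] r(2)[of k] support_fun_upper[OF D v(1), of k q] by linarith
        ultimately have "\<not> 1 / real (Suc (r k)) \<le> infdist (v k) (E (r k))"
          using far[OF v(1), of "r k" k] N by linarith
        moreover have "1 / real (Suc (r k)) \<le> 1 / real (Suc k)"
          using seq_suble[OF r(1), of k] by (simp add: frac_le)
        ultimately show ?thesis by (simp add: v'(2))
      qed
      have "(\<lambda>k. dist (v k) (v' k)) \<longlonglongrightarrow> 0"
        by (rule tendsto_sandwich[of "\<lambda>_. 0" _ _ "\<lambda>k. 1 / real (Suc k)"])
          (use near inv in \<open>auto simp: eventually_sequentially\<close>)
      from LIMSEQ_subseq_LIMSEQ[OF this l(2)]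
      have "(\<lambda>k. dist ((v' \<circ> p) k) ((v \<circ> p) k)) \<longlonglongrightarrow> 0" by (simp add: o_def dist_commute)
      then have "(v' \<circ> p) \<longlonglongrightarrow> l"
        using Lim_transform[OF l(3), of "v' \<circ> p"]
        by (simp add: dist_norm tendsto_norm_zero_iff)
      moreover have "strict_mono (r \<circ> p)" using r(1) l(2) by (rule strict_mono_o)
      moreover have "\<forall>k. (v' \<circ> p) k \<in> E ((r \<circ> p) k)" using v'(1) by simp
      ultimately have "l \<in> C" using PK unfolding PK_converges_def by blast
      moreover have "a \<le> l \<bullet> q"
      proof (rule LIMSEQ_le_const)
        show "(\<lambda>k. (v \<circ> p) k \<bullet> q) \<longlonglongrightarrow> l \<bullet> q" by (intro tendsto_intros l(3))
      qed (use vq in auto)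
      ultimately show False using a support_fun_upper[OF cmpC, of l q] by linarith
    qed
  }
qed

lemma faces_nearly_exposed:
  fixes D :: "'b::euclidean_space set"
  assumes D: "compact D" "convex D" and E: "\<And>n. E n face_of D" "\<And>n. E n \<noteq> {}"
    and PK: "PK_converges E C" and C: "closed C"
  obtains w c where "\<And>n y. y \<in> E n \<Longrightarrow> y \<bullet> w n \<le> c n + 1 / real (Suc n)"
    "\<And>n y. y \<in> D \<Longrightarrow> c n \<le> y \<bullet> w n"
    "\<And>q. (\<lambda>n. support_fun D (q - w n) + c n) \<longlonglongrightarrow> support_fun C q"
proof -
  have "\<exists>w c. (\<forall>y\<in>D. c \<le> y \<bullet> w) \<and> (\<forall>y\<in>E n. y \<bullet> w \<le> c + 1 / real (Suc n)) \<and>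
      (\<forall>y\<in>D. 1 / real (Suc n) \<le> infdist y (E n) \<longrightarrow> c + real n \<le> y \<bullet> w)" for n
    using face_nearly_exposed[OF D E, of "1 / real (Suc n)" n "real n"] by (metis of_nat_0_less_iff zero_less_Suc zero_less_divide_1_iff)
  then obtain w c where wc: "\<And>n y. y \<in> D \<Longrightarrow> c n \<le> y \<bullet> w n" "\<And>n y. y \<in> E n \<Longrightarrow> y \<bullet> w n \<le> c n + 1 / real (Suc n)"
      "\<And>n y. y \<in> D \<Longrightarrow> 1 / real (Suc n) \<le> infdist y (E n) \<Longrightarrow> c n + real n \<le> y \<bullet> w n"
    by metis
  have "(\<lambda>n. support_fun D (q - w n) + c n) \<longlonglongrightarrow> support_fun C q" for q
    by (rule support_fun_nearly_exposing_limit[OF D(1) face_of_imp_subset[OF E(1)] E(2) _ PK C wc(1) wc(2) wc(3)])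
      (use face_of_imp_closed D compact_imp_closed E(1) in blast)+
  with wc that show thesis by blast
qed

text \<open>Move from \<open>p\<close> in almost exposing directions of \<open>E\<close>. The second conclusion says that this motion
  is asymptotically geodesic as seen from the origin: \<open>support_fun D (- z n)\<close> is the norm of \<open>z n\<close> if
  \<open>D\<close> is the dual unit ball.\<close>
lemma face_support_dist_fun_limit:
  fixes D :: "'b::euclidean_space set"
  assumes D: "compact D" "convex D" and E: "E face_of D" "E \<noteq> {}"
  obtains z where "\<And>x. (\<lambda>n. support_dist_fun D (z n) x) \<longlonglongrightarrow> support_dist_fun E p x"
    "(\<lambda>n. support_dist_fun E p (z n) + support_fun D (- z n)) \<longlonglongrightarrow> 0"
proof -
  have cmpE: "compact E" using face_of_imp_compact D E by blast
  have sub: "E \<subseteq> D" using E face_of_imp_subset by blast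
  have inv: "(\<lambda>n. 1 / real (Suc n)) \<longlonglongrightarrow> 0"
    using LIMSEQ_inverse_real_of_nat by (simp add: inverse_eq_divide)
  have PK: "PK_converges (\<lambda>_. E) E"
    unfolding PK_converges_def
  proof (intro conjI ballI allI impI)
    fix x assume "x \<in> E"
    then show "\<exists>X. (\<forall>\<^sub>F n in sequentially. X n \<in> E) \<and> X \<longlonglongrightarrow> x"
      by (intro exI[of _ "\<lambda>_. x"]) auto
  next
    fix r :: "nat \<Rightarrow> nat" and X x
    assume "strict_mono r \<and> (\<forall>k. X k \<in> E) \<and> X \<longlonglongrightarrow> x"
    then show "x \<in> E" using closed_sequentially[OF compact_imp_closed[OF cmpE]] by blast
  qed
  obtain w c where wc: "\<And>n y. y \<in> E \<Longrightarrow> y \<bullet> w n \<le> c n + 1 / real (Suc n)"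
    "\<And>n y. y \<in> D \<Longrightarrow> c n \<le> y \<bullet> w n"
    "\<And>q. (\<lambda>n. support_fun D (q - w n) + c n) \<longlonglongrightarrow> support_fun E q"
    by (rule faces_nearly_exposed[OF D E PK compact_imp_closed[OF cmpE]]) (rule that)
  show thesis
  proof (rule that[of "\<lambda>n. p + w n"])
    fix x
    have "(\<lambda>n. (support_fun D ((x - p) - w n) + c n) - (support_fun D (- p - w n) + c n))
        \<longlonglongrightarrow> support_fun E (x - p) - support_fun E (- p)"
      by (intro tendsto_diff wc)
    then show "(\<lambda>n. support_dist_fun D (p + w n) x) \<longlonglongrightarrow> support_dist_fun E p x"
      by (simp add: support_dist_fun_def algebra_simps)
  next
    have "(\<lambda>n. support_fun E (w n) - c n) \<longlonglongrightarrow> 0"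
    proof (rule tendsto_sandwich[of "\<lambda>_. 0" _ _ "\<lambda>n. 1 / real (Suc n)"])
      show "\<forall>\<^sub>F n in sequentially. 0 \<le> support_fun E (w n) - c n"
      proof (rule always_eventually, rule allI)
        fix n
        obtain y where "y \<in> E" using E(2) by blast
        then show "0 \<le> support_fun E (w n) - c n"
          using wc(2)[of y n] support_fun_upper[OF cmpE, of y "w n"] sub by auto
      qed
      show "\<forall>\<^sub>F n in sequentially. support_fun E (w n) - c n \<le> 1 / real (Suc n)"
      proof (rule always_eventually, rule allI)
        fix n
        have "support_fun E (w n) \<le> c n + 1 / real (Suc n)"
          by (rule support_fun_le[OF cmpE E(2) wc(1)])
        then show "support_fun E (w n) - c n \<le> 1 / real (Suc n)" by simp
      qed
    qed (use inv in auto)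
    then have "(\<lambda>n. (support_fun E (w n) - c n) - support_fun E (- p) +
          (support_fun D (- p - w n) + c n)) \<longlonglongrightarrow> 0 - support_fun E (- p) + support_fun E (- p)"
      by (intro tendsto_intros wc)
    then show "(\<lambda>n. support_dist_fun E p (p + w n) + support_fun D (- (p + w n))) \<longlonglongrightarrow> 0"
      by (simp add: support_dist_fun_def algebra_simps)
  qed
qed

text \<open>The functions \<open>b n = (\<lambda>y. y \<bullet> z n + support_fun D (- z n))\<close> are affine and nonnegative on
  \<open>D\<close>. They are bounded along the sequence at the points of \<open>C\<close>, by \<open>K\<close>, and unbounded at any
  other point of \<open>D\<close>, because a hyperplane separates that point from \<open>C\<close>. The points where
  nonnegative affine functions stay bounded form a face.\<close>
lemma face_if_support_fun_limit:
  fixes D :: "'b::euclidean_space set"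
  assumes D: "compact D" and C: "C \<subseteq> D" "closed C" "convex C" "C \<noteq> {}"
    and lim: "\<And>x. (\<lambda>n. support_dist_fun D (z n) x) \<longlonglongrightarrow> support_fun C x"
    and K: "\<And>n. support_fun C (z n) + support_fun D (- z n) \<le> K"
  shows "C face_of D"
proof -
  define b where "b n y = y \<bullet> z n + support_fun D (- z n)" for n y
  have cmpC: "compact C" using C D compact_Int_closed[OF D C(2)] by (simp add: Int_absorb1)
  have nonneg: "0 \<le> b n y" if "y \<in> D" for n y
    using support_fun_upper[OF D that, of "- z n"] by (simp add: b_def)
  have onC: "b n y \<le> K" if "y \<in> C" for n y
    using support_fun_upper[OF cmpC that, of "z n"] K[of n] by (simp add: b_def)
  have bounded_in: "y \<in> C" if y: "y \<in> D" and B: "\<And>n. b n y \<le> B" for y B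
  proof (rule ccontr)
    assume "y \<notin> C"
    then obtain a \<beta> where a: "a \<bullet> y < \<beta>" "\<And>x. x \<in> C \<Longrightarrow> \<beta> < a \<bullet> x"
      using separating_hyperplane_closed_point[of C y] C by metis
    define x where "x = - a"
    have "support_fun C x \<le> - \<beta>"
      by (rule support_fun_le[OF cmpC C(4)]) (use a(2) in \<open>simp add: x_def inner_commute less_imp_le\<close>)
    then have gap: "y \<bullet> x - support_fun C x > 0"
      using a(1) by (simp add: x_def inner_commute)
    have le: "t * (y \<bullet> x - support_fun C x) \<le> B" if "t \<ge> 0" for t
    proof -
      have "y \<bullet> (t *\<^sub>R x) - B \<le> support_fun C (t *\<^sub>R x)"
      proof (rule LIMSEQ_le_const[OF lim])
        show "\<exists>N. \<forall>n\<ge>N. y \<bullet> (t *\<^sub>R x) - B \<le> support_dist_fun D (z n) (t *\<^sub>R x)"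
        proof (intro exI allI impI)
          fix n
          show "y \<bullet> (t *\<^sub>R x) - B \<le> support_dist_fun D (z n) (t *\<^sub>R x)"
            using support_dist_fun_ge[OF D y, of "t *\<^sub>R x" "z n"] B[of n] by (simp add: b_def)
        qed
      qed
      then show ?thesis
        using support_fun_scaleR[OF cmpC C(4) that] by (simp add: algebra_simps)
    qed
    have "(\<bar>B\<bar> + 1) / (y \<bullet> x - support_fun C x) * (y \<bullet> x - support_fun C x) \<le> B"
      using gap by (intro le) auto
    then show False using gap by simp
  qed
  have "u \<in> C" if uv: "u \<in> D" "v \<in> D" and y: "y \<in> C" "y \<in> open_segment u v" for u v y
  proof -
    obtain t where t: "0 < t" "t < 1" "y = (1 - t) *\<^sub>R u + t *\<^sub>R v"
      using y(2) by (auto simp: in_segment)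
    show ?thesis
    proof (rule bounded_in[OF uv(1)])
      fix n
      have "b n y = (1 - t) * b n u + t * b n v"
        by (simp add: b_def t(3) algebra_simps)
      then have "(1 - t) * b n u \<le> K"
        using onC[OF y(1), of n] nonneg[OF uv(2), of n] t mult_nonneg_nonneg[of t "b n v"] by linarith
      then show "b n u \<le> K / (1 - t)" using t by (simp add: pos_le_divide_eq mult.commute)
    qed
  qed
  then show ?thesis
    unfolding face_of_def using C by (metis open_segment_commute)
qed

section \<open>Limits of distance functions and their conjugates\<close>

lemma lipschitz_pointwise_imp_uniform_limit:
  fixes \<phi> :: "nat \<Rightarrow> 'a::metric_space \<Rightarrow> real"
  assumes lip: "\<And>n x y. \<bar>\<phi> n x - \<phi> n y\<bar> \<le> L * dist x y"
    and lim: "\<And>x. (\<lambda>n. \<phi> n x) \<longlonglongrightarrow> h x" and K: "compact K"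
  shows "uniform_limit K \<phi> h sequentially"
proof (rule uniform_limitI)
  fix e :: real assume e: "e > 0"
  define d where "d = e / (3 * (\<bar>L\<bar> + 1))"
  have d: "d > 0" using e by (simp add: d_def)
  have Ld: "L * t \<le> e / 3" if "0 \<le> t" "t \<le> d" for t
  proof -
    have "L * t \<le> (\<bar>L\<bar> + 1) * d" using that by (intro mult_mono) auto
    also have "\<dots> = e / 3" using e by (simp add: d_def field_simps)
    finally show ?thesis .
  qed
  have lip_h: "\<bar>h x - h y\<bar> \<le> L * dist x y" for x y
  proof (rule LIMSEQ_le_const2)
    show "(\<lambda>n. \<bar>\<phi> n x - \<phi> n y\<bar>) \<longlonglongrightarrow> \<bar>h x - h y\<bar>" by (intro tendsto_intros lim)
  qed (use lip in auto)
  obtain C where C: "finite C" "K \<subseteq> (\<Union>c\<in>C. ball c d)"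
    using compactE_image[OF K, of K "\<lambda>c. ball c d"] d by (metis centre_in_ball open_ball UN_I subsetI)
  have "\<forall>\<^sub>F n in sequentially. \<bar>\<phi> n c - h c\<bar> < e / 3" for c
    using tendstoD[OF lim[of c], of "e / 3"] e by (simp add: dist_real_def)
  then have "\<forall>\<^sub>F n in sequentially. \<forall>c\<in>C. \<bar>\<phi> n c - h c\<bar> < e / 3"
    using C(1) by (simp add: eventually_ball_finite)
  then show "\<forall>\<^sub>F n in sequentially. \<forall>x\<in>K. dist (\<phi> n x) (h x) < e"
  proof eventually_elim
    case (elim n)
    show ?case
    proof
      fix x assume "x \<in> K"
      then obtain c where c: "c \<in> C" "dist c x < d" using C(2) by auto
      have "\<bar>\<phi> n x - \<phi> n c\<bar> \<le> e / 3" "\<bar>h x - h c\<bar> \<le> e / 3"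
        using lip[of n x c] lip_h[of x c] Ld[of "dist x c"] c(2) by (auto simp: dist_commute)
      moreover have "\<bar>\<phi> n c - h c\<bar> < e / 3" using elim c(1) by blast
      ultimately show "dist (\<phi> n x) (h x) < e" unfolding dist_real_def by linarith
    qed
  qed
qed

text \<open>Maximisers in the definition of the support function are subgradients of the approximating
  functions, and subgradients pass to the limit.\<close>
lemma limit_subgradient:
  fixes D :: "'b::euclidean_space set"
  assumes D: "compact D" "D \<noteq> {}"
    and lim: "\<And>x. (\<lambda>n. support_dist_fun D (z n) x) \<longlonglongrightarrow> h x"
  obtains u where "u \<in> D" "\<And>x'. h x + u \<bullet> (x' - x) \<le> h x'"
proof -
  have "\<exists>v\<in>D. support_dist_fun D (z n) x = v \<bullet> x - (v \<bullet> z n + support_fun D (- z n))" for n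
    using support_dist_fun_attained[OF D] by metis
  then obtain v where v: "\<And>n. v n \<in> D"
      "\<And>n. support_dist_fun D (z n) x = v n \<bullet> x - (v n \<bullet> z n + support_fun D (- z n))"
    by metis
  obtain u r where u: "u \<in> D" "strict_mono (r :: nat \<Rightarrow> nat)" "(v \<circ> r) \<longlonglongrightarrow> u"
    using D v(1) unfolding compact_def by blast
  have "h x + u \<bullet> (x' - x) \<le> h x'" for x'
  proof (rule LIMSEQ_le)
    show "(\<lambda>k. support_dist_fun D (z (r k)) x + (v \<circ> r) k \<bullet> (x' - x)) \<longlonglongrightarrow> h x + u \<bullet> (x' - x)"
      using LIMSEQ_subseq_LIMSEQ[OF lim[of x] u(2)]
      by (intro tendsto_intros u(3)) (simp add: o_def)
    show "(\<lambda>k. support_dist_fun D (z (r k)) x') \<longlonglongrightarrow> h x'"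
      using LIMSEQ_subseq_LIMSEQ[OF lim[of x'] u(2)] by (simp add: o_def)
    show "\<exists>N. \<forall>k\<ge>N. support_dist_fun D (z (r k)) x + (v \<circ> r) k \<bullet> (x' - x)
        \<le> support_dist_fun D (z (r k)) x'"
    proof (intro exI allI impI)
      fix k
      show "support_dist_fun D (z (r k)) x + (v \<circ> r) k \<bullet> (x' - x) \<le> support_dist_fun D (z (r k)) x'"
        using support_dist_fun_ge[OF D(1) v(1), of "r k" x' "z (r k)"] v(2)[of "r k"]
        by (simp add: inner_diff_right)
    qed
  qed
  with u(1) that show thesis by blast
qed

text \<open>Half of Fenchel duality for the infimal convolution of an affine function on \<open>D\<close> with
  \<open>M * norm\<close>. If \<open>m\<close> is the minimum, a hyperplane separates the epigraph of the affine function
  from the strict hypograph of the concave function \<open>m - M * norm (_ - y)\<close>. It is not vertical,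
  since that function is finite everywhere, and its slope \<open>x\<close> is as required.\<close>
lemma penalised_minimum_le:
  fixes D :: "'b::euclidean_space set"
  assumes D: "compact D" "convex D" "D \<noteq> {}" and M: "M > 0"
  obtains w x where "w \<in> D" "norm x \<le> M"
    "(w \<bullet> z + support_fun D (- z)) + M * norm (w - y) \<le> y \<bullet> x - support_dist_fun D z x"
proof -
  define f where "f w = w \<bullet> z + support_fun D (- z)" for w
  have "continuous_on D (\<lambda>w. f w + M * norm (w - y))"
    unfolding f_def by (intro continuous_intros)
  from continuous_attains_inf[OF D(1,3) this]
  obtain w where w: "w \<in> D" "\<And>v. v \<in> D \<Longrightarrow> f w + M * norm (w - y) \<le> f v + M * norm (v - y)"
    by blast
  define m where "m = f w + M * norm (w - y)"
  define S where "S = {p :: 'b \<times> real. fst p \<in> D \<and> f (fst p) \<le> snd p}"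
  define T where "T = {p :: 'b \<times> real. snd p < m - M * norm (fst p - y)}"
  have "convex S"
  proof (rule convexI)
    fix p q :: "'b \<times> real" and u v :: real
    assume pq: "p \<in> S" "q \<in> S" and uv: "0 \<le> u" "0 \<le> v" "u + v = 1"
    have v1: "v = 1 - u" using uv by simp
    have "f (u *\<^sub>R fst p + v *\<^sub>R fst q) = u * f (fst p) + v * f (fst q)"
      unfolding v1 f_def by (simp add: inner_add_left algebra_simps)
    also have "\<dots> \<le> u * snd p + v * snd q"
      using pq uv by (intro add_mono mult_left_mono) (auto simp: S_def)
    finally show "u *\<^sub>R p + v *\<^sub>R q \<in> S"
      using pq uv D(2) by (auto simp: S_def convex_def)
  qed
  moreover have "convex T"
  proof (rule convexI)
    fix p q :: "'b \<times> real" and u v :: real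
    assume pq: "p \<in> T" "q \<in> T" and uv: "0 \<le> u" "0 \<le> v" "u + v = 1"
    have v1: "v = 1 - u" using uv by simp
    have "u *\<^sub>R fst p + v *\<^sub>R fst q - y = u *\<^sub>R (fst p - y) + v *\<^sub>R (fst q - y)"
      unfolding v1 by (simp add: algebra_simps)
    then have "norm (u *\<^sub>R fst p + v *\<^sub>R fst q - y) \<le> u * norm (fst p - y) + v * norm (fst q - y)"
      using uv norm_triangle_ineq[of "u *\<^sub>R (fst p - y)" "v *\<^sub>R (fst q - y)"] by simp
    from mult_left_mono[OF this less_imp_le[OF M]]
    have "M * norm (u *\<^sub>R fst p + v *\<^sub>R fst q - y) \<le>
        u * (M * norm (fst p - y)) + v * (M * norm (fst q - y))"
      by (simp only: distrib_left mult.left_commute)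
    moreover have "u * snd p + v * snd q < u * (m - M * norm (fst p - y)) + v * (m - M * norm (fst q - y))"
    proof (cases "u = 0")
      case True
      then show ?thesis using pq uv by (simp add: T_def)
    next
      case False
      then have "u * snd p < u * (m - M * norm (fst p - y))"
        using pq uv by (intro mult_strict_left_mono) (auto simp: T_def)
      moreover have "v * snd q \<le> v * (m - M * norm (fst q - y))"
        using pq uv by (intro mult_left_mono) (auto simp: T_def)
      ultimately show ?thesis by linarith
    qed
    moreover have "u * m + v * m = m" unfolding v1 by (simp add: algebra_simps)
    ultimately show "u *\<^sub>R p + v *\<^sub>R q \<in> T" by (simp add: T_def algebra_simps)
  qed
  moreover have "S \<inter> T = {}"
    using w(2) by (fastforce simp: S_def T_def m_def)
  moreover have "(w, f w) \<in> S" using w(1) by (simp add: S_def)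
  moreover have "(y, m - 1) \<in> T" by (simp add: T_def)
  ultimately obtain a b where a: "a \<noteq> 0" "\<forall>p\<in>S. a \<bullet> p \<le> b" "\<forall>p\<in>T. b \<le> a \<bullet> p"
    using separating_hyperplane_sets[of S T] by blast
  define \<alpha> \<beta> where "\<alpha> = fst a" and "\<beta> = snd a"
  have inS: "\<alpha> \<bullet> v + \<beta> * t \<le> b" if "v \<in> D" "f v \<le> t" for v t
    using bspec[OF a(2), of "(v, t)"] that by (simp add: S_def \<alpha>_def \<beta>_def inner_prod_def)
  have inT: "b \<le> \<alpha> \<bullet> v + \<beta> * t" if "t < m - M * norm (v - y)" for v t
    using bspec[OF a(3), of "(v, t)"] that by (simp add: T_def \<alpha>_def \<beta>_def inner_prod_def)
  have "\<beta> \<le> 0"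
  proof (rule ccontr)
    assume "\<not> \<beta> \<le> 0"
    then have pos: "\<beta> > 0" by simp
    define t where "t = max (f w) ((b - \<alpha> \<bullet> w) / \<beta> + 1)"
    have "\<beta> * ((b - \<alpha> \<bullet> w) / \<beta> + 1) \<le> \<beta> * t"
      using pos by (intro mult_left_mono) (auto simp: t_def)
    moreover have "\<beta> * ((b - \<alpha> \<bullet> w) / \<beta> + 1) = b - \<alpha> \<bullet> w + \<beta>"
      using pos by (simp add: distrib_left)
    moreover have "\<alpha> \<bullet> w + \<beta> * t \<le> b" using w(1) by (rule inS) (simp add: t_def)
    ultimately show False using pos by linarith
  qed
  moreover have "\<beta> \<noteq> 0"
  proof
    assume 0: "\<beta> = 0"
    then have "\<alpha> \<noteq> 0" using a(1) by (simp add: \<alpha>_def \<beta>_def prod_eq_iff zero_prod_def)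
    define v where "v = (- (\<bar>b\<bar> + 1) / (\<alpha> \<bullet> \<alpha>)) *\<^sub>R \<alpha>"
    have "\<alpha> \<bullet> v = - (\<bar>b\<bar> + 1)" using \<open>\<alpha> \<noteq> 0\<close> by (simp add: v_def)
    moreover have "b \<le> \<alpha> \<bullet> v" using inT[of "m - M * norm (v - y) - 1" v] 0 by simp
    ultimately show False by linarith
  qed
  ultimately have neg: "\<beta> < 0" by simp
  define x e where "x = (1 / - \<beta>) *\<^sub>R \<alpha>" and "e = b / \<beta>"
  have lower: "x \<bullet> v + e \<le> f v" if "v \<in> D" for v
    using inS[OF that, of "f v"] neg by (simp add: x_def e_def field_simps)
  have upper: "m - M * norm (v - y) \<le> x \<bullet> v + e" for v
  proof (rule field_le_epsilon)
    fix \<epsilon> :: real assume "\<epsilon> > 0"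
    then show "m - M * norm (v - y) \<le> x \<bullet> v + e + \<epsilon>"
      using inT[of "m - M * norm (v - y) - \<epsilon>" v] neg by (simp add: x_def e_def field_simps)
  qed
  have "norm x \<le> M"
  proof (rule ccontr)
    assume "\<not> norm x \<le> M"
    then have big: "norm x > M" by simp
    then have gap: "norm x * (norm x - M) > 0" using M by (intro mult_pos_pos) linarith+
    define t where "t = (\<bar>x \<bullet> y + e - m\<bar> + 1) / (norm x * (norm x - M))"
    have t: "t > 0" using gap by (simp add: t_def)
    have "m - M * (t * norm x) \<le> x \<bullet> y - t * (norm x)\<^sup>2 + e"
      using upper[of "y - t *\<^sub>R x"] t by (simp add: inner_diff_right power2_norm_eq_inner)
    then have "t * (norm x * (norm x - M)) \<le> x \<bullet> y + e - m"
      by (simp add: algebra_simps power2_eq_square)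
    moreover have "t * (norm x * (norm x - M)) = \<bar>x \<bullet> y + e - m\<bar> + 1"
      using gap t_def nonzero_eq_divide_eq by (metis less_irrefl)
    ultimately show False by linarith
  qed
  moreover obtain v where v: "v \<in> D" "support_dist_fun D z x = v \<bullet> x - f v"
    using support_dist_fun_attained[OF D(1,3), of z x] unfolding f_def by metis
  then have "support_dist_fun D z x \<le> - e" using lower[OF v(1)] by (simp add: inner_commute)
  moreover have "m \<le> x \<bullet> y + e" using upper[of y] by simp
  ultimately show thesis
    using that[OF w(1), of x] by (simp add: m_def f_def inner_commute)
qed

text \<open>The recovery half of epi-convergence. Here \<open>s\<close> bounds the conjugate of \<open>h\<close> at \<open>y\<close>; as the
  convergence to \<open>h\<close> is uniform on the ball of radius \<open>M\<close>, the penalised minima of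
  \<open>penalised_minimum_le\<close> are eventually less than \<open>s + \<epsilon>\<close>.\<close>
lemma recovery_points:
  fixes D :: "'b::euclidean_space set"
  assumes D: "compact D" "convex D" "D \<noteq> {}"
    and lim: "\<And>x. (\<lambda>n. support_dist_fun D (z n) x) \<longlonglongrightarrow> h x"
    and s: "\<And>x. y \<bullet> x - h x \<le> s" and \<epsilon>: "\<epsilon> > 0"
  shows "\<forall>\<^sub>F n in sequentially. \<exists>w\<in>D. norm (w - y) < \<epsilon> \<and> w \<bullet> z n + support_fun D (- z n) < s + \<epsilon>"
proof -
  obtain R where R: "\<And>y. y \<in> D \<Longrightarrow> norm y \<le> R"
    using compact_imp_bounded[OF D(1)] unfolding bounded_iff by blast
  have "h 0 = 0"
    using LIMSEQ_unique[OF lim[of 0]] by (simp add: support_dist_fun_zero)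
  then have s0: "s \<ge> 0" using s[of 0] by simp
  \<comment> \<open>At a point at distance \<open>\<epsilon>\<close> from \<open>y\<close> the penalty alone would be \<open>s + \<epsilon>\<close>.\<close>
  define M where "M = (s + \<epsilon>) / \<epsilon>"
  have M: "M > 0" using s0 \<epsilon> by (simp add: M_def)
  have "uniform_limit (cball 0 M) (\<lambda>n. support_dist_fun D (z n)) h sequentially"
    by (rule lipschitz_pointwise_imp_uniform_limit[where L=R])
      (use support_dist_fun_lipschitz[OF D(1,3) R] lim in auto)
  from uniform_limitD[OF this \<epsilon>] show ?thesis
  proof eventually_elim
    case (elim n)
    obtain w x where w: "w \<in> D" "norm x \<le> M"
      "(w \<bullet> z n + support_fun D (- z n)) + M * norm (w - y) \<le> y \<bullet> x - support_dist_fun D (z n) x"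
      by (rule penalised_minimum_le[OF D M])
    have "dist (support_dist_fun D (z n) x) (h x) < \<epsilon>"
      using elim w(2) by simp
    then have "y \<bullet> x - support_dist_fun D (z n) x < s + \<epsilon>"
      using s[of x] by (auto simp: dist_real_def)
    then have *: "(w \<bullet> z n + support_fun D (- z n)) + M * norm (w - y) < s + \<epsilon>"
      using w(3) by linarith
    have "0 \<le> w \<bullet> z n + support_fun D (- z n)"
      using support_fun_upper[OF D(1) w(1), of "- z n"] by simp
    then have "M * norm (w - y) < M * \<epsilon>" using * \<epsilon> by (simp add: M_def)
    then have "norm (w - y) < \<epsilon>" using M by simp
    moreover have "w \<bullet> z n + support_fun D (- z n) < s + \<epsilon>"
      using * mult_nonneg_nonneg[OF less_imp_le[OF M] norm_ge_zero[of "w - y"]] by linarith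
    ultimately show ?case using w(1) by blast
  qed
qed

text \<open>If \<open>k\<close> is the least dimension of faces that carry recovery points for \<open>y\<close> at infinitely many
  indices, then such points are uniformly deep inside their faces. The relative boundary of a face of
  dimension \<open>k\<close> consists of points of smaller faces, so near \<open>y\<close> the affine functions are at least
  \<open>s + \<eta>\<close> there. If a recovery point \<open>w\<close> were very close to the relative boundary of its face, the
  affine function would fall steeply along the line from a boundary point through \<open>w\<close>. This line leaves
  the face again at a boundary point whose value is small and which is therefore far from \<open>y\<close>; there the
  affine function would be negative.\<close>
lemma deep_recovery_points:
  fixes D :: "'b::euclidean_space set"
  assumes D: "compact D" "convex D"
    and nonneg: "\<And>n w. w \<in> D \<Longrightarrow> 0 \<le> w \<bullet> z n + e n"
    and s: "s \<ge> 0"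
    and rec: "\<And>\<epsilon>. \<epsilon> > 0 \<Longrightarrow>
      \<forall>\<^sub>F n in sequentially. \<exists>w\<in>D. norm (w - y) < \<epsilon> \<and> w \<bullet> z n + e n < s + \<epsilon>"
  obtains \<delta> where "\<delta> > 0" "\<And>\<epsilon>. \<epsilon> > 0 \<Longrightarrow> \<exists>\<^sub>F n in sequentially.
      \<exists>F w. F face_of D \<and> w \<in> F \<and> norm (w - y) < \<epsilon> \<and> w \<bullet> z n + e n < s + \<epsilon> \<and>
        cball w \<delta> \<inter> affine hull F \<subseteq> F"
proof -
  define f where "f n w = w \<bullet> z n + e n" for n w
  define Q where "Q k \<epsilon> n \<longleftrightarrow> (\<exists>F w. F face_of D \<and> aff_dim F \<le> int k \<and> w \<in> F \<and>
      norm (w - y) < \<epsilon> \<and> f n w < s + \<epsilon>)" for k \<epsilon> n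
  define k where "k = (LEAST k. \<forall>\<epsilon>>0. \<exists>\<^sub>F n in sequentially. Q k \<epsilon> n)"
  have inQ: "Q (DIM('b)) \<epsilon> n" if "\<exists>w\<in>D. norm (w - y) < \<epsilon> \<and> f n w < s + \<epsilon>" for \<epsilon> n
    unfolding Q_def using that face_of_refl[OF D(2)] aff_dim_le_DIM[of D] by blast
  have "\<forall>\<epsilon>>0. \<exists>\<^sub>F n in sequentially. Q (DIM('b)) \<epsilon> n"
  proof (intro allI impI)
    fix \<epsilon> :: real assume "\<epsilon> > 0"
    then have "\<forall>\<^sub>F n in sequentially. Q (DIM('b)) \<epsilon> n"
      using rec[of \<epsilon>] unfolding f_def[symmetric] by (auto elim!: eventually_mono intro!: inQ)
    then show "\<exists>\<^sub>F n in sequentially. Q (DIM('b)) \<epsilon> n"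
      by (intro eventually_frequently) auto
  qed
  then have k: "\<forall>\<epsilon>>0. \<exists>\<^sub>F n in sequentially. Q k \<epsilon> n"
    unfolding k_def by (rule LeastI)
  obtain \<eta> where \<eta>: "\<eta> > 0" "\<forall>\<^sub>F n in sequentially. \<forall>G w. G face_of D \<and> aff_dim G < int k \<and> w \<in> G \<and>
      norm (w - y) < \<eta> \<longrightarrow> s + \<eta> \<le> f n w"
  proof (cases k)
    case 0
    have "\<not> (aff_dim G < 0 \<and> w \<in> G)" for G :: "'b set" and w
      using aff_dim_geq[of G] aff_dim_empty[of G] by auto
    then show thesis using that[of 1] 0 by auto
  next
    case (Suc j)
    then have "j < k" by simp
    then have "\<not> (\<forall>\<epsilon>>0. \<exists>\<^sub>F n in sequentially. Q j \<epsilon> n)"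
      unfolding k_def by (rule not_less_Least)
    then obtain \<eta> where \<eta>: "\<eta> > 0" "\<forall>\<^sub>F n in sequentially. \<not> Q j \<eta> n"
      by (auto simp: not_frequently)
    from \<eta>(2) have "\<forall>\<^sub>F n in sequentially. \<forall>G w. G face_of D \<and> aff_dim G < int k \<and> w \<in> G \<and>
        norm (w - y) < \<eta> \<longrightarrow> s + \<eta> \<le> f n w"
    proof (rule eventually_mono, intro allI impI, elim conjE)
      fix n G w
      assume *: "\<not> Q j \<eta> n" "G face_of D" "aff_dim G < int k" "w \<in> G" "norm (w - y) < \<eta>"
      then have "aff_dim G \<le> int j" using Suc by simp
      with * show "s + \<eta> \<le> f n w" unfolding Q_def by (meson not_less)
    qed
    with \<eta>(1) show thesis by (rule that)
  qed
  \<comment> \<open>The first bound keeps boundary points within \<open>\<delta>\<close> of \<open>w\<close> at distance less than \<open>\<eta>\<close> from \<open>y\<close>; the second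
    one is what the fall of at least \<open>\<eta> / 2\<close> over a length \<open>\<delta>\<close>, continued over a length \<open>\<eta> / 2\<close>, requires
    in order to exceed \<open>s + \<eta>\<close>.\<close>
  define \<delta> where "\<delta> = min (\<eta> / 4) (\<eta>\<^sup>2 / (4 * (s + \<eta> + 1)))"
  have "\<delta> > 0" using \<eta>(1) s by (simp add: \<delta>_def)
  moreover have "\<delta> \<le> \<eta> / 4" unfolding \<delta>_def by (rule min.cobounded1)
  ultimately have \<delta>: "\<delta> > 0" "\<delta> \<le> \<eta> / 4" .
  have "\<delta> \<le> \<eta>\<^sup>2 / (4 * (s + \<eta> + 1))" by (simp add: \<delta>_def)
  then have \<delta>3: "4 * \<delta> * (s + \<eta> + 1) \<le> \<eta>\<^sup>2"
    using \<eta>(1) s by (simp add: pos_le_divide_eq mult_ac)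
  show thesis
  proof (rule that[OF \<delta>(1)])
    fix \<epsilon> :: real assume \<epsilon>: "\<epsilon> > 0"
    define \<epsilon>' where "\<epsilon>' = min \<epsilon> (\<eta> / 2)"
    have \<epsilon>': "\<epsilon>' > 0" "\<epsilon>' \<le> \<epsilon>" "\<epsilon>' \<le> \<eta> / 2" using \<epsilon> \<eta>(1) by (auto simp: \<epsilon>'_def)
    from k \<epsilon>'(1) have "\<exists>\<^sub>F n in sequentially. Q k \<epsilon>' n" by blast
    from frequently_eventually_conj[OF this \<eta>(2)]
    have "\<exists>\<^sub>F n in sequentially. Q k \<epsilon>' n \<and> (\<forall>G w. G face_of D \<and> aff_dim G < int k \<and> w \<in> G \<and>
      norm (w - y) < \<eta> \<longrightarrow> s + \<eta> \<le> f n w)"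
      by (rule frequently_elim1) blast
    then show "\<exists>\<^sub>F n in sequentially. \<exists>F w. F face_of D \<and> w \<in> F \<and> norm (w - y) < \<epsilon> \<and>
        w \<bullet> z n + e n < s + \<epsilon> \<and> cball w \<delta> \<inter> affine hull F \<subseteq> F"
    proof (rule frequently_elim1, elim conjE)
      fix n assume "Q k \<epsilon>' n"
      assume high: "\<forall>G w. G face_of D \<and> aff_dim G < int k \<and> w \<in> G \<and>
        norm (w - y) < \<eta> \<longrightarrow> s + \<eta> \<le> f n w"
      obtain F w where F: "F face_of D" "aff_dim F \<le> int k" and w: "w \<in> F" "norm (w - y) < \<epsilon>'"
          "f n w < s + \<epsilon>'"
        using \<open>Q k \<epsilon>' n\<close> unfolding Q_def by blast
      have cF: "convex F" "compact F" "F \<subseteq> D"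
        using F(1) D face_of_imp_convex face_of_imp_compact face_of_imp_subset by blast+
      have bdry: "s + \<eta> \<le> f n v" if v: "v \<in> F" "v \<notin> rel_interior F" "norm (v - y) < \<eta>" for v
      proof -
        obtain a where a: "\<And>u. u \<in> F \<Longrightarrow> a \<bullet> v \<le> a \<bullet> u"
            "\<And>u. u \<in> rel_interior F \<Longrightarrow> a \<bullet> v < a \<bullet> u"
          using supporting_hyperplane_rel_boundary[OF cF(1) v(1,2)] by metis
        define G where "G = F \<inter> {u. a \<bullet> u = a \<bullet> v}"
        have G: "G face_of F"
          unfolding G_def using cF(1) a(1) by (rule face_of_Int_supporting_hyperplane_ge)
        have "rel_interior F \<noteq> {}" using rel_interior_eq_empty[OF cF(1)] v(1) by blast
        then obtain u where u: "u \<in> rel_interior F" by blast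
        then have "u \<notin> G" using a(2)[OF u] by (simp add: G_def)
        moreover have "u \<in> F" using u rel_interior_subset by blast
        ultimately have "G \<noteq> F" by blast
        then have "aff_dim G < int k" using face_of_aff_dim_lt[OF cF(1) G] F(2) by simp
        moreover have "G face_of D" using face_of_trans[OF G F(1)] .
        moreover have "v \<in> G" using v(1) by (simp add: G_def)
        ultimately show ?thesis using high v(3) by blast
      qed
      have wri: "w \<in> rel_interior F"
      proof (rule ccontr)
        assume "w \<notin> rel_interior F"
        moreover have "norm (w - y) < \<eta>" using w(2) \<epsilon>' \<eta>(1) by linarith
        ultimately have "s + \<eta> \<le> f n w" by (rule bdry[OF w(1)])
        then show False using w(3) \<epsilon>' \<eta>(1) by linarith
      qed
      have "cball w \<delta> \<inter> affine hull F \<subseteq> F"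
      proof
        fix u assume "u \<in> cball w \<delta> \<inter> affine hull F"
        then have u: "norm (u - w) \<le> \<delta>" "u \<in> affine hull F" by (auto simp: dist_norm norm_minus_commute)
        show "u \<in> F"
        proof (rule ccontr)
          assume un: "u \<notin> F"
          define l where "l = u - w"
          have l0: "l \<noteq> 0" "- l \<noteq> 0" using un w(1) by (auto simp: l_def)
          have waff: "w \<in> affine hull F" using w(1) by (rule hull_inc)
          have "2 *\<^sub>R w + (- 1) *\<^sub>R u \<in> affine hull F"
            using affine_affine_hull waff u(2) by (rule mem_affine) simp
          then have aff: "w + - l \<in> affine hull F" "w + l \<in> affine hull F"
            using u(2) by (auto simp: l_def scaleR_2 add_diff_eq)
          obtain d where d: "d > 0" "w + d *\<^sub>R l \<in> rel_frontier F"
              "\<And>t. 0 \<le> t \<Longrightarrow> t < d \<Longrightarrow> w + t *\<^sub>R l \<in> rel_interior F"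
            using ray_to_rel_frontier[OF compact_imp_bounded[OF cF(2)] wri aff(2) l0(1)] by metis
          obtain d' where d': "d' > 0" "w + d' *\<^sub>R (- l) \<in> rel_frontier F"
            using ray_to_rel_frontier[OF compact_imp_bounded[OF cF(2)] wri aff(1) l0(2)] by metis
          have front: "v \<in> F \<and> v \<notin> rel_interior F" if "v \<in> rel_frontier F" for v
            using that compact_imp_closed[OF cF(2)] by (simp add: rel_frontier_def)
          have d1: "d \<le> 1"
          proof (rule ccontr)
            assume "\<not> d \<le> 1"
            then have "w + 1 *\<^sub>R l \<in> rel_interior F" using d(3)[of 1] by simp
            then show False using un rel_interior_subset by (auto simp: l_def)
          qed
          define A where "A = l \<bullet> z n"
          have f1: "f n (w + t *\<^sub>R l) = f n w + t * A" for t
            by (simp add: f_def A_def inner_add_left)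
          have "norm (w + d *\<^sub>R l - y) \<le> norm (w - y) + d * norm l"
            using norm_triangle_ineq[of "w - y" "d *\<^sub>R l"] d(1) by (simp add: algebra_simps)
          moreover have "d * norm l \<le> 1 * \<delta>"
            using d(1) d1 u(1) by (intro mult_mono) (auto simp: l_def)
          ultimately have "norm (w + d *\<^sub>R l - y) < \<eta>" using w(2) \<epsilon>' \<delta> \<eta>(1) by linarith
          then have "s + \<eta> \<le> f n w + d * A"
            using bdry front[OF d(2)] f1 by metis
          then have dA: "\<eta> / 2 \<le> d * A" using w(3) \<epsilon>' by linarith
          then have "d * A > 0" using \<eta>(1) by linarith
          then have A: "A > 0" using d(1) by (simp add: zero_less_mult_iff)
          then have "d * A \<le> 1 * A" using d1 by (intro mult_right_mono) auto
          then have A2: "\<eta> / 2 \<le> A" using dA by linarith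
          \<comment> \<open>The exit point on the other side of \<open>w\<close>.\<close>
          define v where "v = w + (- d') *\<^sub>R l"
          have v: "v \<in> F" "v \<notin> rel_interior F" using front[OF d'(2)] by (auto simp: v_def)
          have fv: "f n v = f n w - d' * A" unfolding v_def f1 by simp
          have "0 \<le> f n v" using nonneg[of v n] v(1) cF(3) by (auto simp: f_def)
          then have dA': "d' * A < s + \<eta>" using fv w(3) \<epsilon>' \<eta>(1) by linarith
          have "d' * A > 0" using d' A by simp
          then have "f n v < s + \<eta>" using fv w(3) \<epsilon>' \<eta>(1) by linarith
          then have "\<eta> \<le> norm (v - y)" using bdry[OF v] by linarith
          also have "\<dots> \<le> norm (w - y) + d' * norm l"
            using norm_triangle_ineq[of "w - y" "(- d') *\<^sub>R l"] d'(1) by (simp add: v_def algebra_simps)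
          also have "d' * norm l \<le> d' * \<delta>"
            using d'(1) u(1) by (simp add: l_def)
          finally have "\<eta> / 2 \<le> d' * \<delta>" using w(2) \<epsilon>' by linarith
          then have "(\<eta> / 2) * (\<eta> / 2) \<le> (d' * \<delta>) * A"
            using A2 \<eta>(1) d' \<delta>(1) by (intro mult_mono) auto
          also have "\<dots> = \<delta> * (d' * A)" by simp
          also have "\<dots> \<le> \<delta> * (s + \<eta>)" using dA' \<delta>(1) by (intro mult_left_mono) auto
          finally have "\<eta>\<^sup>2 \<le> 4 * \<delta> * (s + \<eta>)" by (simp add: power2_eq_square)
          moreover have "4 * \<delta> * (s + \<eta> + 1) = 4 * \<delta> * (s + \<eta>) + 4 * \<delta>" by (simp add: algebra_simps)
          ultimately show False using \<delta>3 \<delta>(1) by linarith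
        qed
      qed
      moreover have "norm (w - y) < \<epsilon>" "w \<bullet> z n + e n < s + \<epsilon>"
        using w(2,3) \<epsilon>'(2) by (auto simp: f_def)
      ultimately show "\<exists>F w. F face_of D \<and> w \<in> F \<and> norm (w - y) < \<epsilon> \<and>
          w \<bullet> z n + e n < s + \<epsilon> \<and> cball w \<delta> \<inter> affine hull F \<subseteq> F"
        using F(1) w(1) by blast
    qed
  qed
qed

text \<open>Step from \<open>w\<close> by \<open>\<delta>\<close> against the component \<open>p\<close> of the slope along \<open>F\<close>: the value falls by
  \<open>\<delta> * norm p\<close> and is still nonnegative.\<close>
lemma slope_along_set_bound:
  fixes F :: "'b::euclidean_space set"
  assumes w: "w \<in> F" "cball w \<delta> \<inter> affine hull F \<subseteq> F" and \<delta>: "\<delta> > 0"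
    and nonneg: "\<And>u. u \<in> F \<Longrightarrow> 0 \<le> u \<bullet> z + e"
  obtains p where "\<And>u. u \<in> F \<Longrightarrow> (u - w) \<bullet> z = (u - w) \<bullet> p" "\<delta> * norm p \<le> w \<bullet> z + e"
proof -
  define S where "S = (\<lambda>u. - w + u) ` F"
  have hull: "affine hull F = (\<lambda>x. w + x) ` span S"
    unfolding S_def by (rule affine_hull_span_gen) (rule hull_inc[OF w(1)])
  obtain p q where pq: "p \<in> span S" "\<And>v. v \<in> span S \<Longrightarrow> orthogonal q v" "z = p + q"
    using orthogonal_subspace_decomp_exists[of S z] by metis
  have eq: "v \<bullet> z = v \<bullet> p" if "v \<in> span S" for v
    using pq(2)[OF that] by (simp add: pq(3) inner_add_right orthogonal_def inner_commute)
  have "(u - w) \<bullet> z = (u - w) \<bullet> p" if "u \<in> F" for u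
    by (rule eq, rule span_base) (use that in \<open>auto simp: S_def image_iff intro!: bexI[of _ u]\<close>)
  moreover have "\<delta> * norm p \<le> w \<bullet> z + e"
  proof (cases "p = 0")
    case True
    then show ?thesis using nonneg[OF w(1)] by simp
  next
    case False
    define v where "v = (- \<delta> / norm p) *\<^sub>R p"
    have v: "v \<in> span S" unfolding v_def using pq(1) by (rule span_scale)
    have "norm v = \<delta>" using False \<delta> by (simp add: v_def)
    then have "w + v \<in> F" using w(2) v hull by (auto simp: dist_norm)
    from nonneg[OF this] have "0 \<le> w \<bullet> z + e + v \<bullet> z" by (simp add: inner_add_left)
    also have "v \<bullet> z = - \<delta> * norm p"
      using False unfolding eq[OF v] by (simp add: v_def power2_norm_eq_inner[symmetric] power2_eq_square)
    finally show ?thesis by simp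
  qed
  ultimately show thesis by (rule that)
qed

text \<open>With \<open>s\<close> the value at \<open>y\<close> of the conjugate of \<open>h\<close>, the conjugate is shown to be
  the affine function \<open>u \<mapsto> s + (u - y) \<bullet> P\<close> on \<open>F\<close> and infinite elsewhere: its domain lies in
  \<open>F\<close> because \<open>y\<close> is a relatively interior point of the domain; on \<open>F\<close> it lies below the affine
  function, which is the limit of the given affine functions on the sets \<open>G n\<close>; and a convex
  function below an affine one that touches it at a relatively interior point equals it.\<close>
lemma limit_eq_support_dist_fun:
  fixes D :: "'b::euclidean_space set"
  assumes D: "compact D" "convex D" "D \<noteq> {}"
    and lim: "\<And>x. (\<lambda>n. support_dist_fun D (z n) x) \<longlonglongrightarrow> h x"
    and y: "y \<in> rel_interior {y. \<exists>t. \<forall>x. y \<bullet> x - h x \<le> t}"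
    and s: "\<And>t. (\<And>x. y \<bullet> x - h x \<le> t) \<Longrightarrow> s \<le> t"
    and G: "\<And>n. G n \<subseteq> D" and PK: "PK_converges G F" and F: "F face_of D"
    and W: "\<And>n. W n \<in> G n" "W \<longlonglongrightarrow> y"
      "\<And>n. W n \<bullet> z n + support_fun D (- z n) < s + 1 / real (Suc n)"
    and deep: "\<delta> > 0" "\<And>n. cball (W n) \<delta> \<inter> affine hull G n \<subseteq> G n"
    and p: "\<And>n u. u \<in> G n \<Longrightarrow> (u - W n) \<bullet> z n = (u - W n) \<bullet> p n" "p \<longlonglongrightarrow> P"
  shows "h = support_dist_fun F P"
proof -
  define dom where "dom = {y. \<exists>t. \<forall>x. y \<bullet> x - h x \<le> t}"
  have inv: "(\<lambda>n. 1 / real (Suc n)) \<longlonglongrightarrow> 0"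
    using LIMSEQ_inverse_real_of_nat by (simp add: inverse_eq_divide)
  have cmpF: "compact F" "F \<subseteq> D" using F D face_of_imp_compact face_of_imp_subset by blast+
  have yF: "y \<in> F" by (rule PK_limit_mem[OF PK _ W(2)]) (use W(1) in simp)
  then have Fn: "F \<noteq> {}" by blast
  have h0: "h 0 = 0"
    using LIMSEQ_unique[OF lim[of 0]] by (simp add: support_dist_fun_zero)
  have "dom \<subseteq> D"
  proof
    fix v assume "v \<in> dom"
    then obtain t where t: "\<And>x. v \<bullet> x - h x \<le> t" by (auto simp: dom_def)
    have "\<exists>w\<in>D. dist w v < \<epsilon>" if "\<epsilon> > 0" for \<epsilon>
      using eventually_happens'[OF sequentially_bot recovery_points[OF D lim t that]]
      by (auto simp: dist_norm)
    then have "v \<in> closure D" by (simp add: closure_approachable)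
    then show "v \<in> D" using compact_imp_closed[OF D(1)] by simp
  qed
  then have domF: "dom \<subseteq> F"
    by (rule subset_of_face_of[OF F]) (use y yF in \<open>auto simp: dom_def\<close>)
  have ge: "u \<bullet> x - s - (u - y) \<bullet> P \<le> h x" if u: "u \<in> F" for u x
  proof -
    obtain U where U: "\<forall>\<^sub>F n in sequentially. U n \<in> G n" "U \<longlonglongrightarrow> u"
      using PK u by (rule PK_limit_approx)
    have "(\<lambda>n. U n \<bullet> x - (s + 1 / real (Suc n)) - (U n - W n) \<bullet> p n)
        \<longlonglongrightarrow> u \<bullet> x - (s + 0) - (u - y) \<bullet> P"
      by (intro tendsto_intros U W inv p)
    moreover have "\<forall>\<^sub>F n in sequentially.
        U n \<bullet> x - (s + 1 / real (Suc n)) - (U n - W n) \<bullet> p n \<le> support_dist_fun D (z n) x"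
      using U(1)
    proof eventually_elim
      case (elim n)
      then have "U n \<in> D" using G by blast
      from support_dist_fun_ge[OF D(1) this, of x "z n"] W(3)[of n] p(1)[OF elim]
      show ?case by (simp add: inner_diff_left)
    qed
    ultimately have "u \<bullet> x - (s + 0) - (u - y) \<bullet> P \<le> h x"
      by (rule tendsto_le[OF sequentially_bot lim])
    then show ?thesis by simp
  qed
  obtain R where R: "\<And>v. v \<in> D \<Longrightarrow> norm v \<le> R" "R > 0"
    using compact_imp_bounded[OF D(1)] unfolding bounded_pos by blast
  \<comment> \<open>Small enough that reflecting a point of \<open>G n\<close> through \<open>W n\<close> with ratio \<open>\<tau>\<close> stays within \<open>\<delta>\<close> of \<open>W n\<close>.\<close>
  define \<tau> where "\<tau> = \<delta> / (2 * R)"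
  have \<tau>: "\<tau> > 0" using deep(1) R(2) by (simp add: \<tau>_def)
  have reflect: "y - \<tau> *\<^sub>R (u - y) \<in> F" if u: "u \<in> F" for u
  proof -
    obtain U where U: "\<forall>\<^sub>F n in sequentially. U n \<in> G n" "U \<longlonglongrightarrow> u"
      using PK u by (rule PK_limit_approx)
    have "\<forall>\<^sub>F n in sequentially. W n - \<tau> *\<^sub>R (U n - W n) \<in> G n"
      using U(1)
    proof eventually_elim
      case (elim n)
      have "norm (U n - W n) \<le> 2 * R"
      proof -
        have "norm (U n) \<le> R" "norm (W n) \<le> R" using R(1) elim W(1) G by blast+
        then show ?thesis using norm_triangle_ineq4[of "U n" "W n"] by linarith
      qed
      then have "\<tau> * norm (U n - W n) \<le> \<tau> * (2 * R)"
        using \<tau> by (intro mult_left_mono) auto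
      moreover have "\<tau> * (2 * R) = \<delta>" using R(2) by (simp add: \<tau>_def)
      ultimately have "norm (\<tau> *\<^sub>R (U n - W n)) \<le> \<delta>" using \<tau> by simp
      then have "W n - \<tau> *\<^sub>R (U n - W n) \<in> cball (W n) \<delta>"
        by (simp add: dist_norm)
      moreover have "(1 + \<tau>) *\<^sub>R W n + (- \<tau>) *\<^sub>R U n \<in> affine hull G n"
        by (rule mem_affine[OF affine_affine_hull])
          (use hull_inc[OF W(1)] hull_inc[OF elim] in auto)
      then have "W n - \<tau> *\<^sub>R (U n - W n) \<in> affine hull G n" by (simp add: algebra_simps)
      ultimately show ?case using deep(2)[of n] by blast
    qed
    moreover have "(\<lambda>n. W n - \<tau> *\<^sub>R (U n - W n)) \<longlonglongrightarrow> y - \<tau> *\<^sub>R (u - y)"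
      by (intro tendsto_intros U W)
    ultimately show ?thesis by (rule PK_limit_mem[OF PK])
  qed
  have le: "\<exists>u\<in>F. h x \<le> u \<bullet> x - s - (u - y) \<bullet> P" for x
  proof -
    obtain u where u: "u \<in> D" "\<And>x'. h x + u \<bullet> (x' - x) \<le> h x'"
      using limit_subgradient[OF D(1,3) lim] by metis
    define t where "t = u \<bullet> x - h x"
    have t: "u \<bullet> x' - h x' \<le> t" for x' using u(2)[of x'] by (simp add: t_def inner_diff_right)
    then have "u \<in> dom" by (auto simp: dom_def)
    then have uF: "u \<in> F" using domF by blast
    define c where "c = (u - y) \<bullet> P"
    \<comment> \<open>\<open>y\<close> is the convex combination of \<open>u\<close> and its reflection with weights proportional to \<open>\<tau>\<close> and \<open>1\<close>, so
      bounds for the conjugate at these two points bound its value \<open>s\<close> at \<open>y\<close>.\<close>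
    have "s \<le> (s + \<tau> * t - \<tau> * c) / (1 + \<tau>)"
    proof (rule s)
      fix x'
      have "(y - \<tau> *\<^sub>R (u - y)) \<bullet> x' - s - ((y - \<tau> *\<^sub>R (u - y)) - y) \<bullet> P \<le> h x'"
        by (rule ge[OF reflect[OF uF]])
      then have 1: "y \<bullet> x' - \<tau> * (u \<bullet> x') + \<tau> * (y \<bullet> x') - s + \<tau> * c \<le> h x'"
        by (simp add: c_def inner_diff_left right_diff_distrib)
      have "\<tau> * (u \<bullet> x' - h x') \<le> \<tau> * t" using t \<tau> by (intro mult_left_mono) auto
      then have 2: "\<tau> * (u \<bullet> x') - \<tau> * h x' \<le> \<tau> * t" by (simp add: right_diff_distrib)
      have "(y \<bullet> x' - h x') * (1 + \<tau>) \<le> s + \<tau> * t - \<tau> * c"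
        using 1 2 by (simp add: algebra_simps)
      then show "y \<bullet> x' - h x' \<le> (s + \<tau> * t - \<tau> * c) / (1 + \<tau>)"
        using \<tau> by (simp add: pos_le_divide_eq)
    qed
    then have "s * (1 + \<tau>) \<le> s + \<tau> * t - \<tau> * c" using \<tau> by (simp add: pos_le_divide_eq)
    then have "\<tau> * s \<le> \<tau> * (t - c)" by (simp add: algebra_simps)
    then have "s \<le> t - c" using \<tau> by simp
    then show ?thesis using uF by (intro bexI[of _ u]) (simp_all add: t_def c_def)
  qed
  have eq: "h x = support_fun F (x - P) + (y \<bullet> P - s)" for x
  proof (rule antisym)
    obtain u where "u \<in> F" "h x \<le> u \<bullet> x - s - (u - y) \<bullet> P" using le by blast
    then show "h x \<le> support_fun F (x - P) + (y \<bullet> P - s)"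
      using support_fun_upper[OF cmpF(1), of u "x - P"] by (simp add: inner_diff_left inner_diff_right)
    have "support_fun F (x - P) \<le> h x - (y \<bullet> P - s)"
      by (rule support_fun_le[OF cmpF(1) Fn])
        (use ge[of _ x] in \<open>simp add: inner_diff_left inner_diff_right algebra_simps\<close>)
    then show "support_fun F (x - P) + (y \<bullet> P - s) \<le> h x" by simp
  qed
  show ?thesis
  proof
    fix x
    show "h x = support_dist_fun F P x"
      using eq[of x] eq[of 0] h0 by (simp add: support_dist_fun_def)
  qed
qed

theorem limit_is_support_dist_fun_of_face:
  fixes D :: "'b::euclidean_space set"
  assumes D: "compact D" "convex D" "D \<noteq> {}" and cl: "PK_closed (extreme_sets D)"
    and lim: "\<And>x. (\<lambda>n. support_dist_fun D (z n) x) \<longlonglongrightarrow> h x"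
  obtains F P where "F face_of D" "F \<noteq> {}" "h = support_dist_fun F P"
proof -
  define dom where "dom = {y. \<exists>t. \<forall>x. y \<bullet> x - h x \<le> t}"
  have h0: "h 0 = 0"
    using LIMSEQ_unique[OF lim[of 0]] by (simp add: support_dist_fun_zero)
  have "convex dom"
  proof (rule convexI)
    fix a b and u v :: real
    assume ab: "a \<in> dom" "b \<in> dom" and uv: "0 \<le> u" "0 \<le> v" "u + v = 1"
    obtain ta tb where t: "\<And>x. a \<bullet> x - h x \<le> ta" "\<And>x. b \<bullet> x - h x \<le> tb"
      using ab by (auto simp: dom_def)
    have "(u *\<^sub>R a + v *\<^sub>R b) \<bullet> x - h x \<le> u * ta + v * tb" for x
    proof -
      have v1: "v = 1 - u" using uv by simp
      have "(u *\<^sub>R a + v *\<^sub>R b) \<bullet> x - h x = u * (a \<bullet> x - h x) + v * (b \<bullet> x - h x)"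
        unfolding v1 by (simp add: inner_add_left inner_diff_left algebra_simps)
      also have "\<dots> \<le> u * ta + v * tb" using t uv by (intro add_mono mult_left_mono) auto
      finally show ?thesis .
    qed
    then show "u *\<^sub>R a + v *\<^sub>R b \<in> dom" by (auto simp: dom_def)
  qed
  moreover have "dom \<noteq> {}"
  proof -
    obtain u where "\<And>x'. h 0 + u \<bullet> (x' - 0) \<le> h x'"
      using limit_subgradient[OF D(1,3) lim] by metis
    then have "u \<in> dom" by (auto simp: dom_def h0 intro!: exI[of _ 0])
    then show ?thesis by blast
  qed
  ultimately obtain y where y: "y \<in> rel_interior dom"
    using rel_interior_eq_empty by blast
  then obtain t where t: "\<And>x. y \<bullet> x - h x \<le> t"
    using subsetD[OF rel_interior_subset y] by (auto simp: dom_def)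
  define s where "s = (SUP x. y \<bullet> x - h x)"
  have bdd: "bdd_above (range (\<lambda>x. y \<bullet> x - h x))" using t by (auto intro!: bdd_aboveI)
  have s: "y \<bullet> x - h x \<le> s" for x
    unfolding s_def using bdd by (rule cSUP_upper[OF UNIV_I])
  have s_least: "s \<le> t" if "\<And>x. y \<bullet> x - h x \<le> t" for t
    unfolding s_def using that by (intro cSUP_least) auto
  have s0: "s \<ge> 0" using s[of 0] h0 by simp
  define e where "e n = support_fun D (- z n)" for n
  have nonneg: "0 \<le> w \<bullet> z n + e n" if "w \<in> D" for n w
    using support_fun_upper[OF D(1) that, of "- z n"] by (simp add: e_def)
  have rec: "\<forall>\<^sub>F n in sequentially. \<exists>w\<in>D. norm (w - y) < \<epsilon> \<and> w \<bullet> z n + e n < s + \<epsilon>"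
    if "\<epsilon> > 0" for \<epsilon>
    unfolding e_def by (rule recovery_points[OF D lim s that])
  obtain \<delta> where \<delta>: "\<delta> > 0" "\<And>\<epsilon>. \<epsilon> > 0 \<Longrightarrow> \<exists>\<^sub>F n in sequentially.
      \<exists>F w. F face_of D \<and> w \<in> F \<and> norm (w - y) < \<epsilon> \<and> w \<bullet> z n + e n < s + \<epsilon> \<and>
        cball w \<delta> \<inter> affine hull F \<subseteq> F"
    by (rule deep_recovery_points[OF D(1,2) nonneg s0 rec]) (assumption | (rule that, assumption, blast))+
  obtain r where r: "strict_mono (r :: nat \<Rightarrow> nat)"
      "\<And>k. \<exists>F w. F face_of D \<and> w \<in> F \<and> norm (w - y) < 1 / real (Suc k) \<and>
        w \<bullet> z (r k) + e (r k) < s + 1 / real (Suc k) \<and> cball w \<delta> \<inter> affine hull F \<subseteq> F"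
  proof (rule frequently_sequentially_subseq)
    show "\<exists>\<^sub>F n in sequentially. \<exists>F w. F face_of D \<and> w \<in> F \<and> norm (w - y) < 1 / real (Suc k) \<and>
        w \<bullet> z n + e n < s + 1 / real (Suc k) \<and> cball w \<delta> \<inter> affine hull F \<subseteq> F" for k
      by (rule \<delta>(2)) simp
  qed (rule that)
  then obtain G W where GW: "\<And>k. G k face_of D" "\<And>k. W k \<in> G k" "\<And>k. norm (W k - y) < 1 / real (Suc k)"
      "\<And>k. W k \<bullet> z (r k) + e (r k) < s + 1 / real (Suc k)" "\<And>k. cball (W k) \<delta> \<inter> affine hull G k \<subseteq> G k"
    by metis
  have GD: "G k \<subseteq> D" for k using GW(1) face_of_imp_subset by blast
  have "\<exists>p. (\<forall>u\<in>G k. (u - W k) \<bullet> z (r k) = (u - W k) \<bullet> p) \<and> \<delta> * norm p \<le> W k \<bullet> z (r k) + e (r k)" for k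
    using slope_along_set_bound[OF GW(2,5) \<delta>(1), where z="z (r k)" and e="e (r k)" for k] nonneg GD
    by (metis subsetD)
  then obtain p where p: "\<And>k u. u \<in> G k \<Longrightarrow> (u - W k) \<bullet> z (r k) = (u - W k) \<bullet> p k"
      "\<And>k. \<delta> * norm (p k) \<le> W k \<bullet> z (r k) + e (r k)"
    by metis
  have "p k \<in> cball 0 ((s + 1) / \<delta>)" for k
  proof -
    have "1 / real (Suc k) \<le> 1" by simp
    then have "\<delta> * norm (p k) \<le> s + 1" using p(2)[of k] GW(4)[of k] by linarith
    then show ?thesis using \<delta>(1) by (simp add: pos_le_divide_eq mult.commute)
  qed
  then obtain P q where q: "strict_mono (q :: nat \<Rightarrow> nat)" "(p \<circ> q) \<longlonglongrightarrow> P"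
    using compact_cball[of "0 :: 'b" "(s + 1) / \<delta>"] unfolding compact_def by blast
  obtain q' F where q': "strict_mono (q' :: nat \<Rightarrow> nat)" "closed F" "PK_converges ((G \<circ> q) \<circ> q') F"
  proof (rule PK_convergent_subsequence[OF D(1), of "G \<circ> q"])
    show "\<And>n. (G \<circ> q) n \<subseteq> D" "\<And>n. (G \<circ> q) n \<noteq> {}" using GD GW(2) by auto
    show "\<And>n. closed ((G \<circ> q) n)"
      using face_of_imp_closed[OF D(2) compact_imp_closed[OF D(1)] GW(1)] by simp
  qed
  define m where "m = q \<circ> q'"
  have m: "strict_mono m" unfolding m_def using q(1) q'(1) by (rule strict_mono_o)
  have PK: "PK_converges (\<lambda>n. G (m n)) F" using q'(3) by (simp add: m_def o_def)
  have "G (m n) \<in> extreme_sets D" for n using GW(1,2) by (auto simp: extreme_sets_def)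
  then have "F \<in> extreme_sets D" using q'(2) PK by (rule PK_closedD[OF cl])
  then have F: "F face_of D" "F \<noteq> {}" by (auto simp: extreme_sets_def)
  have small: "1 / real (Suc (m n)) \<le> 1 / real (Suc n)" for n
    using seq_suble[OF m, of n] by (simp add: frac_le)
  have inv: "(\<lambda>n. 1 / real (Suc n)) \<longlonglongrightarrow> 0"
    using LIMSEQ_inverse_real_of_nat by (simp add: inverse_eq_divide)
  have "h = support_dist_fun F P"
  proof (rule limit_eq_support_dist_fun[OF D, where z="\<lambda>n. z (r (m n))" and G="\<lambda>n. G (m n)"
        and W="\<lambda>n. W (m n)" and p="\<lambda>n. p (m n)" and y=y and s=s and \<delta>=\<delta>])
    show "(\<lambda>n. support_dist_fun D (z (r (m n))) x) \<longlonglongrightarrow> h x" for x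
      using LIMSEQ_subseq_LIMSEQ[OF lim strict_mono_o[OF r(1) m]] by (simp add: o_def)
    show "y \<in> rel_interior {y. \<exists>t. \<forall>x. y \<bullet> x - h x \<le> t}" using y by (simp add: dom_def)
    show "(\<lambda>n. W (m n)) \<longlonglongrightarrow> y"
    proof (rule LIMSEQ_I)
      fix c :: real assume "c > 0"
      then obtain N where N: "1 / real (Suc n) < c" if "n \<ge> N" for n
        using order_tendstoD(2)[OF inv] by (auto simp: eventually_sequentially)
      then show "\<exists>N. \<forall>n\<ge>N. norm (W (m n) - y) < c"
        using GW(3) small by (meson le_less_trans less_trans)
    qed
    show "(\<lambda>n. p (m n)) \<longlonglongrightarrow> P"
      using LIMSEQ_subseq_LIMSEQ[OF q(2) q'(1)] by (simp add: m_def o_def)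
    show "W (m n) \<bullet> z (r (m n)) + support_fun D (- z (r (m n))) < s + 1 / real (Suc n)" for n
      using GW(4)[of "m n"] small[of n] unfolding e_def by linarith
  qed (use s_least GD PK F GW(2,5) \<delta>(1) p(1) in auto)
  with F that show thesis by blast
qed

section \<open>Closedness of the set of faces in terms of limits\<close>

theorem limits_of_support_dist_funs_if_faces_closed:
  fixes D :: "'b::euclidean_space set"
  assumes D: "compact D" "convex D" "D \<noteq> {}" and cl: "PK_closed (extreme_sets D)"
    and lim: "\<And>x. (\<lambda>n. support_dist_fun D (z n) x) \<longlonglongrightarrow> h x"
  obtains z' where "\<And>x. (\<lambda>n. support_dist_fun D (z' n) x) \<longlonglongrightarrow> h x"
    "(\<lambda>n. h (z' n) + support_fun D (- z' n)) \<longlonglongrightarrow> 0"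
proof -
  obtain F P where F: "F face_of D" "F \<noteq> {}" "h = support_dist_fun F P"
    by (rule limit_is_support_dist_fun_of_face[OF D cl lim])
  show thesis
    by (rule face_support_dist_fun_limit[OF D(1,2) F(1,2), of P])
      (rule that, use F(3) in auto)
qed

text \<open>The support function of a limit \<open>C\<close> of faces is a limit of distance functions by
  \<open>faces_nearly_exposed\<close>; the assumption then makes \<open>C\<close> a face.\<close>
theorem faces_closed_if_limits_of_support_dist_funs:
  fixes D :: "'b::euclidean_space set"
  assumes D: "compact D" "convex D" "D \<noteq> {}"
    and geo: "\<And>z h. (\<And>x. (\<lambda>n. support_dist_fun D (z n) x) \<longlonglongrightarrow> h x) \<Longrightarrow>
      \<exists>z' K. (\<forall>x. (\<lambda>n. support_dist_fun D (z' n) x) \<longlonglongrightarrow> h x) \<and>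
        (\<forall>n. h (z' n) + support_fun D (- z' n) \<le> K)"
  shows "PK_closed (extreme_sets D)"
  unfolding PK_closed_def
proof (intro conjI allI impI subsetI)
  fix E assume "E \<in> extreme_sets D"
  then show "E \<in> Collect closed"
    using face_of_imp_closed[OF D(2) compact_imp_closed[OF D(1)]] by (simp add: extreme_sets_def)
next
  fix E C assume *: "(\<forall>n. E n \<in> extreme_sets D) \<and> closed C \<and> PK_converges E C"
  then have E: "\<And>n. E n \<in> extreme_sets D" and C: "closed C" and PK: "PK_converges E C" by auto
  have En: "E n face_of D" "E n \<noteq> {}" for n using E by (auto simp: extreme_sets_def)
  have sub: "E n \<subseteq> D" for n using En(1) face_of_imp_subset by blast
  have Cn: "C \<noteq> {}" using PK_limit_nonempty[OF PK sub En(2) D(1)] .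
  have CD: "C \<subseteq> D" using PK_limit_subset[OF PK sub compact_imp_closed[OF D(1)]] .
  have Cc: "convex C" using PK_limit_convex[OF PK face_of_imp_convex[OF En(1)]] .
  have cmpC: "compact C" using C CD compact_Int_closed[OF D(1) C] by (simp add: Int_absorb1)
  obtain w c where wc: "\<And>q. (\<lambda>n. support_fun D (q - w n) + c n) \<longlonglongrightarrow> support_fun C q"
    by (rule faces_nearly_exposed[OF D(1,2) En PK C]) (rule that)
  have lim: "(\<lambda>n. support_dist_fun D (w n) x) \<longlonglongrightarrow> support_fun C x" for x
  proof -
    have "(\<lambda>n. (support_fun D (x - w n) + c n) - (support_fun D (0 - w n) + c n))
        \<longlonglongrightarrow> support_fun C x - support_fun C 0"
      by (intro tendsto_diff wc)
    then show ?thesis by (simp add: support_dist_fun_def support_fun_zero[OF cmpC Cn])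
  qed
  obtain z K where z: "\<forall>x. (\<lambda>n. support_dist_fun D (z n) x) \<longlonglongrightarrow> support_fun C x"
      "\<forall>n. support_fun C (z n) + support_fun D (- z n) \<le> K"
    using geo[OF lim] by blast
  then have "C face_of D"
    by (intro face_if_support_fun_limit[OF D(1) CD C Cc Cn]) auto
  then show "C \<in> extreme_sets D" using Cn by (simp add: extreme_sets_def)
qed

section \<open>Horofunctions and Busemann points as limits of sequences\<close>

lemma dist_fun_lipschitz: "\<bar>dist_fun z x - dist_fun z y\<bar> \<le> 1 * dist x y"
proof -
  have "\<bar>norm (z - x) - norm (z - y)\<bar> \<le> norm ((z - x) - (z - y))" by (rule norm_triangle_ineq3)
  then show ?thesis by (simp add: dist_fun_def dist_norm norm_minus_commute)
qed

lemma dist_fun_limit_uniform: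
  fixes z :: "nat \<Rightarrow> 'a::real_normed_vector"
  assumes "\<And>x. (\<lambda>n. dist_fun (z n) x) \<longlonglongrightarrow> h x" "compact K"
  shows "uniform_limit K (\<lambda>n. dist_fun (z n)) h sequentially"
  using dist_fun_lipschitz assms by (rule lipschitz_pointwise_imp_uniform_limit)

lemma dist_fun_limit_in_closure:
  fixes z :: "nat \<Rightarrow> 'a::real_normed_vector"
  assumes lim: "\<And>x. (\<lambda>n. dist_fun (z n) x) \<longlonglongrightarrow> h x"
  shows "h \<in> ucc_topology closure_of range dist_fun"
proof -
  have lip: "\<bar>h x - h y\<bar> \<le> dist x y" for x y
  proof (rule LIMSEQ_le_const2)
    show "(\<lambda>n. \<bar>dist_fun (z n) x - dist_fun (z n) y\<bar>) \<longlonglongrightarrow> \<bar>h x - h y\<bar>"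
      by (intro tendsto_intros lim)
  qed (use dist_fun_lipschitz in auto)
  have cont: "continuous_on UNIV h"
    unfolding continuous_on_iff
  proof (intro ballI allI impI)
    fix x and e :: real assume "e > 0"
    then show "\<exists>d>0. \<forall>x'\<in>UNIV. dist x' x < d \<longrightarrow> dist (h x') (h x) < e"
      using lip by (intro exI[of _ e]) (auto simp: dist_real_def intro: le_less_trans)
  qed
  have contd: "continuous_on UNIV (dist_fun w)" for w :: 'a
    unfolding dist_fun_def by (intro continuous_intros)
  show ?thesis
    unfolding in_closure_of
  proof (intro conjI allI impI, goal_cases)
    case 1
    show ?case using cont by (simp add: topspace_ucc_topology)
  next
    case (2 U)
    then have "h \<in> U" "ucc_open U" by (auto simp: openin_ucc_topology)
    then obtain K e where K: "compact K" "e > 0" "ucc_nbhd h K e \<subseteq> U"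
      unfolding ucc_open_def by blast
    have "\<forall>\<^sub>F n in sequentially. \<forall>x\<in>K. dist (dist_fun (z n) x) (h x) < e"
      using dist_fun_limit_uniform[OF lim K(1)] K(2) by (rule uniform_limitD)
    from eventually_happens'[OF sequentially_bot this]
    obtain n where "\<forall>x\<in>K. dist (dist_fun (z n) x) (h x) < e" ..
    then have "dist_fun (z n) \<in> ucc_nbhd h K e"
      using contd by (simp add: ucc_nbhd_def dist_real_def)
    then show ?case using K(3) by blast
  qed
qed

text \<open>The sets \<open>B n\<close> exhaust the space by compact sets, which lets a sequence do the work of the
  neighbourhoods.\<close>
lemma dist_fun_limit_if_in_closure:
  fixes h :: "'a::real_normed_vector \<Rightarrow> real" and B :: "nat \<Rightarrow> 'a set"
  assumes h: "h \<in> ucc_topology closure_of range dist_fun"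
    and B: "\<And>n. compact (B n)" "\<And>x. \<exists>N. \<forall>n\<ge>N. x \<in> B n"
  obtains z where "\<And>x. (\<lambda>n. dist_fun (z n) x) \<longlonglongrightarrow> h x"
proof -
  have cont: "continuous_on UNIV h"
    using h by (simp add: in_closure_of topspace_ucc_topology)
  have "\<exists>z. \<forall>x\<in>B n. \<bar>dist_fun z x - h x\<bar> < 1 / real (Suc n)" for n
  proof -
    \<comment> \<open>The bound \<open>d\<close> keeps the supremum of the error strictly below \<open>1 / Suc n\<close>, which makes \<open>U\<close> open.\<close>
    define U where "U = {g. continuous_on UNIV g \<and> (\<exists>d < 1 / real (Suc n). \<forall>x\<in>B n. \<bar>g x - h x\<bar> \<le> d)}"
    have "ucc_open U"
      unfolding ucc_open_def
    proof (intro conjI ballI)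
      fix g assume "g \<in> U"
      then obtain d where d: "d < 1 / real (Suc n)" "\<forall>x\<in>B n. \<bar>g x - h x\<bar> \<le> d" "continuous_on UNIV g"
        by (auto simp: U_def)
      define r where "r = (1 / real (Suc n) - d) / 2"
      have "r > 0" using d(1) by (simp add: r_def)
      moreover have "ucc_nbhd g (B n) r \<subseteq> U"
      proof
        fix k assume k: "k \<in> ucc_nbhd g (B n) r"
        have "\<bar>k x - h x\<bar> \<le> d + r" if "x \<in> B n" for x
        proof -
          have "\<bar>k x - g x\<bar> < r" "\<bar>g x - h x\<bar> \<le> d" using k d(2) that by (auto simp: ucc_nbhd_def)
          then show ?thesis by linarith
        qed
        moreover have "d + r < 1 / real (Suc n)" using d(1) unfolding r_def by argo
        ultimately show "k \<in> U" using k by (auto simp: U_def ucc_nbhd_def)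
      qed
      ultimately show "\<exists>K e. compact K \<and> e > 0 \<and> ucc_nbhd g K e \<subseteq> U"
        using B(1) by blast
    qed (auto simp: U_def)
    moreover have "h \<in> U" using cont by (auto simp: U_def intro!: exI[of _ 0])
    ultimately have "\<exists>z. dist_fun z \<in> U"
      using h by (auto simp: in_closure_of openin_ucc_topology)
    then obtain g where "g \<in> range dist_fun" "g \<in> U" by blast
    then show ?thesis by (auto simp: U_def) (meson le_less_trans)
  qed
  then obtain z where z: "\<And>n x. x \<in> B n \<Longrightarrow> \<bar>dist_fun (z n) x - h x\<bar> < 1 / real (Suc n)"
    by metis
  show thesis
  proof (rule that[of z])
    fix x
    obtain N where N: "\<And>n. n \<ge> N \<Longrightarrow> x \<in> B n" using B(2) by blast
    have "(\<lambda>n. dist_fun (z n) x - h x) \<longlonglongrightarrow> 0"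
    proof (rule Lim_null_comparison)
      show "\<forall>\<^sub>F n in sequentially. norm (dist_fun (z n) x - h x) \<le> 1 / real (Suc n)"
        using z N by (auto simp: eventually_sequentially intro!: exI[of _ N] less_imp_le)
      show "(\<lambda>n. 1 / real (Suc n)) \<longlonglongrightarrow> 0"
        using LIMSEQ_inverse_real_of_nat by (simp add: inverse_eq_divide)
    qed
    then show "(\<lambda>n. dist_fun (z n) x) \<longlonglongrightarrow> h x" by (simp add: LIM_zero_iff)
  qed
qed

text \<open>Along an almost-geodesic \<open>h + norm\<close> stays bounded: the point at parameter \<open>s\<close> lies almost
  on a shortest path from the base point to the later points, whose distance functions tend to \<open>h\<close>.\<close>
lemma busemann_point_bounded:
  fixes h :: "'a::real_normed_vector \<Rightarrow> real"
  assumes "busemann_point h"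
  obtains z K where "\<And>x. (\<lambda>n. dist_fun (z n) x) \<longlonglongrightarrow> h x" "\<And>n. h (z n) + norm (z n) \<le> K"
proof -
  obtain T \<gamma> where T: "almost_geodesic T \<gamma>"
    and unif: "\<And>K. compact K \<Longrightarrow> uniform_limit K (\<lambda>t. dist_fun (\<gamma> t)) h (inf at_top (principal T))"
    using assms unfolding busemann_point_def by blast
  have unb: "\<not> bounded T" "T \<subseteq> {0..}" using T by (auto simp: almost_geodesic_def)
  have big: "\<exists>t\<in>T. a \<le> t" for a
  proof (rule ccontr)
    assume "\<not> (\<exists>t\<in>T. a \<le> t)"
    then have "T \<subseteq> {0..a}" using unb(2) by force
    then show False using unb(1) bounded_subset[OF bounded_closed_interval] by blast
  qed
  have ptw: "((\<lambda>t. dist_fun (\<gamma> t) x) \<longlongrightarrow> h x) (inf at_top (principal T))" for x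
    using tendsto_uniform_limitI[OF unif[of "{x}"]] by simp
  obtain N where N: "\<And>s t. s \<in> T \<Longrightarrow> t \<in> T \<Longrightarrow> N \<le> s \<Longrightarrow> s \<le> t \<Longrightarrow>
      \<bar>dist (\<gamma> t) (\<gamma> s) + dist (\<gamma> s) (\<gamma> 0) - t\<bar> < 1"
    using T unfolding almost_geodesic_def by (metis zero_less_one)
  have "\<exists>t\<in>T. max N (real n) \<le> t" for n using big by blast
  then obtain t where t: "\<And>n. t n \<in> T" "\<And>n. max N (real n) \<le> t n" by metis
  have at: "filterlim t (inf at_top (principal T)) sequentially"
    unfolding filterlim_inf filterlim_principal
  proof
    have "\<forall>\<^sub>F n in sequentially. real n \<le> t n" using t(2) by auto
    then show "filterlim t at_top sequentially"
      by (rule filterlim_at_top_mono[OF filterlim_real_sequentially])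
  qed (use t(1) in simp)
  have lim: "(\<lambda>n. dist_fun (\<gamma> (t n)) x) \<longlonglongrightarrow> h x" for x
    using filterlim_compose[OF ptw at] .
  have "h (\<gamma> (t n)) + norm (\<gamma> (t n)) \<le> 2 + 2 * norm (\<gamma> 0)" for n
  proof -
    have "h (\<gamma> (t n)) \<le> 2 + 2 * norm (\<gamma> 0) - norm (\<gamma> (t n))"
    proof (rule tendsto_upperbound[OF lim _ sequentially_bot])
      have "filterlim t at_top sequentially" using at by (simp add: filterlim_inf)
      then have "\<forall>\<^sub>F m in sequentially. t n \<le> t m" by (simp add: filterlim_at_top)
      then show "\<forall>\<^sub>F m in sequentially. dist_fun (\<gamma> (t m)) (\<gamma> (t n)) \<le> 2 + 2 * norm (\<gamma> 0) - norm (\<gamma> (t n))"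
      proof eventually_elim
        case (elim m)
        have "\<bar>dist (\<gamma> (t m)) (\<gamma> (t n)) + dist (\<gamma> (t n)) (\<gamma> 0) - t m\<bar> < 1"
          using N[OF t(1) t(1) _ elim] t(2)[of n] by simp
        moreover have "\<bar>dist (\<gamma> (t m)) (\<gamma> (t m)) + dist (\<gamma> (t m)) (\<gamma> 0) - t m\<bar> < 1"
          using N[OF t(1) t(1), of m m] t(2)[of m] by simp
        moreover have "dist (\<gamma> (t m)) (\<gamma> 0) \<le> norm (\<gamma> (t m)) + norm (\<gamma> 0)"
          by (simp add: dist_norm norm_triangle_ineq4)
        moreover have "norm (\<gamma> (t n)) - norm (\<gamma> 0) \<le> dist (\<gamma> (t n)) (\<gamma> 0)"
          by (simp add: dist_norm norm_triangle_ineq2)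
        ultimately show ?case by (simp add: dist_fun_def dist_norm[symmetric])
      qed
    qed
    then show ?thesis by simp
  qed
  then show thesis by (rule that[OF lim])
qed

text \<open>A sequence along which \<open>h + norm\<close> tends to \<open>0\<close> has a subsequence that is an almost-geodesic
  from the origin, parametrised by the norm: choose each point so late that its distance function
  agrees with \<open>h\<close> at the earlier points up to a small error.\<close>
lemma busemann_pointI:
  fixes h :: "'a::real_normed_vector \<Rightarrow> real"
  assumes lim: "\<And>x. (\<lambda>n. dist_fun (z n) x) \<longlonglongrightarrow> h x"
    and geo: "(\<lambda>n. h (z n) + norm (z n)) \<longlonglongrightarrow> 0"
    and far: "filterlim (\<lambda>n. norm (z n)) at_top sequentially"
    and h: "h \<in> horofunction_boundary"
  shows "busemann_point h"
proof -
  \<comment> \<open>The norms increase strictly, so that they can serve as parameters.\<close>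
  have "\<exists>r :: nat \<Rightarrow> nat. \<forall>n. (\<forall>i<n. r i < r n \<and> norm (z (r i)) < norm (z (r n)) \<and>
      \<bar>dist_fun (z (r n)) (z (r i)) - h (z (r i))\<bar> < 1 / real (Suc n)) \<and> norm (z (r n)) > real n"
  proof (rule dependent_wellorder_choice)
    fix r s :: "nat \<Rightarrow> nat" and n m
    assume "\<And>i. i < n \<Longrightarrow> r i = s i"
    then show "((\<forall>i<n. r i < m \<and> norm (z (r i)) < norm (z m) \<and>
      \<bar>dist_fun (z m) (z (r i)) - h (z (r i))\<bar> < 1 / real (Suc n)) \<and> norm (z m) > real n) =
      ((\<forall>i<n. s i < m \<and> norm (z (s i)) < norm (z m) \<and>
      \<bar>dist_fun (z m) (z (s i)) - h (z (s i))\<bar> < 1 / real (Suc n)) \<and> norm (z m) > real n)"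
      by auto
  next
    fix n :: nat and r :: "nat \<Rightarrow> nat"
    have "\<forall>\<^sub>F m in sequentially. r i < m \<and> norm (z (r i)) < norm (z m) \<and>
      \<bar>dist_fun (z m) (z (r i)) - h (z (r i))\<bar> < 1 / real (Suc n)" for i
    proof (intro eventually_conj)
      show "\<forall>\<^sub>F m in sequentially. r i < m" by (rule eventually_gt_at_top)
      show "\<forall>\<^sub>F m in sequentially. norm (z (r i)) < norm (z m)"
        using far unfolding filterlim_at_top_dense by blast
      show "\<forall>\<^sub>F m in sequentially. \<bar>dist_fun (z m) (z (r i)) - h (z (r i))\<bar> < 1 / real (Suc n)"
        using tendstoD[OF lim[of "z (r i)"], of "1 / real (Suc n)"] by (simp add: dist_real_def)
    qed
    then have "\<forall>\<^sub>F m in sequentially. \<forall>i\<in>{..<n}. r i < m \<and> norm (z (r i)) < norm (z m) \<and>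
      \<bar>dist_fun (z m) (z (r i)) - h (z (r i))\<bar> < 1 / real (Suc n)"
      by (simp add: eventually_ball_finite)
    moreover have "\<forall>\<^sub>F m in sequentially. real n < norm (z m)"
      using far unfolding filterlim_at_top_dense by blast
    ultimately have "\<forall>\<^sub>F m in sequentially. (\<forall>i<n. r i < m \<and> norm (z (r i)) < norm (z m) \<and>
      \<bar>dist_fun (z m) (z (r i)) - h (z (r i))\<bar> < 1 / real (Suc n)) \<and> norm (z m) > real n"
      by eventually_elim auto
    then show "\<exists>m. (\<forall>i<n. r i < m \<and> norm (z (r i)) < norm (z m) \<and>
      \<bar>dist_fun (z m) (z (r i)) - h (z (r i))\<bar> < 1 / real (Suc n)) \<and> norm (z m) > real n"
      by (rule eventually_happens'[OF sequentially_bot])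
  qed
  then obtain r :: "nat \<Rightarrow> nat" where r: "\<And>i n. i < n \<Longrightarrow> r i < r n"
      "\<And>i n. i < n \<Longrightarrow> norm (z (r i)) < norm (z (r n))"
      "\<And>i n. i < n \<Longrightarrow> \<bar>dist_fun (z (r n)) (z (r i)) - h (z (r i))\<bar> < 1 / real (Suc n)"
      "\<And>n. real n < norm (z (r n))"
    by blast
  have mono: "strict_mono r" using r(1) by (simp add: strict_mono_def)
  define t where "t n = norm (z (r n))" for n
  have t_less: "t i < t n \<longleftrightarrow> i < n" for i n
    using r(2)[of i n] r(2)[of n i] unfolding t_def by (metis less_asym less_irrefl linorder_neqE_nat)
  have t_eq: "t i = t n \<longleftrightarrow> i = n" for i n using t_less by (metis less_irrefl linorder_neqE_nat)
  have t_pos: "t n > 0" "t n > real n" for n using r(4)[of n] by (auto simp: t_def intro: le_less_trans[of 0 "real n"])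
  define T where "T = insert 0 (range t)"
  define \<gamma> where "\<gamma> s = (if s = 0 then 0 else z (r (inv t s)))" for s
  have "inj t" using t_eq by (auto intro: injI)
  then have \<gamma>t: "\<gamma> (t n) = z (r n)" for n using t_pos(1)[of n] by (simp add: \<gamma>_def)
  have \<gamma>0: "\<gamma> 0 = 0" by (simp add: \<gamma>_def)
  have late: "\<exists>n. s = t n \<and> N \<le> n" if s: "s \<in> T" "t N \<le> s" for s N
  proof -
    have "s \<noteq> 0" using s(2) t_pos(1)[of N] by linarith
    then obtain n where "s = t n" using s(1) by (auto simp: T_def)
    then show ?thesis using s(2) t_less[of n N] by (metis linorder_not_less)
  qed
  have "almost_geodesic T \<gamma>"
    unfolding almost_geodesic_def
  proof (intro conjI allI impI)
    show "T \<subseteq> {0..}" using t_pos(1) by (auto simp: T_def less_imp_le)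
    show "0 \<in> T" by (simp add: T_def)
    show "\<not> bounded T"
    proof
      assume "bounded T"
      then obtain B where B: "\<And>s. s \<in> T \<Longrightarrow> norm s \<le> B" by (auto simp: bounded_iff)
      obtain n :: nat where "B < real n" using reals_Archimedean2 by blast
      moreover have "norm (t n) \<le> B" by (rule B) (simp add: T_def)
      ultimately show False using t_pos(2)[of n] by simp
    qed
  next
    fix \<epsilon> :: real assume \<epsilon>: "\<epsilon> > 0"
    have "(\<lambda>n. h (z (r n)) + norm (z (r n))) \<longlonglongrightarrow> 0"
      using LIMSEQ_subseq_LIMSEQ[OF geo mono] by (simp add: o_def)
    then have "\<forall>\<^sub>F n in sequentially. \<bar>h (z (r n)) + norm (z (r n))\<bar> < \<epsilon> / 2"
      using \<epsilon> by (auto dest!: tendstoD[of _ _ _ "\<epsilon> / 2"] simp: dist_real_def)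
    then obtain N1 where N1: "\<And>n. n \<ge> N1 \<Longrightarrow> \<bar>h (z (r n)) + norm (z (r n))\<bar> < \<epsilon> / 2"
      by (auto simp: eventually_sequentially)
    obtain N2 where N2: "1 / real (Suc N2) < \<epsilon> / 2"
      using nat_approx_posE[of "\<epsilon> / 2"] \<epsilon> by auto
    define N where "N = max N1 N2"
    show "\<exists>N. \<forall>s\<in>T. \<forall>t\<in>T. N \<le> s \<and> s \<le> t \<longrightarrow> \<bar>dist (\<gamma> t) (\<gamma> s) + dist (\<gamma> s) (\<gamma> 0) - t\<bar> < \<epsilon>"
    proof (intro exI[of _ "t N"] ballI impI, elim conjE)
      fix s u assume su: "s \<in> T" "u \<in> T" "t N \<le> s" "s \<le> u"
      obtain i where i: "s = t i" "N \<le> i" using late su(1,3) by blast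
      obtain n where n: "u = t n" using late[OF su(2), of N] su(3,4) by force
      have "i \<le> n" using su(4) i n t_less[of n i] by (metis linorder_not_less)
      show "\<bar>dist (\<gamma> u) (\<gamma> s) + dist (\<gamma> s) (\<gamma> 0) - u\<bar> < \<epsilon>"
      proof (cases "i = n")
        case True
        then show ?thesis using \<epsilon> unfolding i(1) n \<gamma>t \<gamma>0 by (simp add: t_def)
      next
        case False
        then have "i < n" using \<open>i \<le> n\<close> by simp
        have "1 / real (Suc n) \<le> 1 / real (Suc N2)"
          using \<open>i < n\<close> i(2) by (intro frac_le) (auto simp: N_def)
        then have "\<bar>dist_fun (z (r n)) (z (r i)) - h (z (r i))\<bar> < \<epsilon> / 2"
          using r(3)[OF \<open>i < n\<close>] N2 by linarith
        moreover have "\<bar>h (z (r i)) + norm (z (r i))\<bar> < \<epsilon> / 2"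
          using N1[of i] i(2) by (simp add: N_def)
        ultimately have "\<bar>dist_fun (z (r n)) (z (r i)) + norm (z (r i))\<bar> < \<epsilon>" by linarith
        then show ?thesis
          unfolding i(1) n \<gamma>t \<gamma>0 by (simp add: dist_fun_def dist_norm t_def algebra_simps)
      qed
    qed
  qed
  moreover have "uniform_limit K (\<lambda>s. dist_fun (\<gamma> s)) h (inf at_top (principal T))" if K: "compact K" for K
  proof (rule uniform_limitI)
    fix e :: real assume e: "e > 0"
    have "(\<lambda>n. dist_fun (z (r n)) x) \<longlonglongrightarrow> h x" for x
      using LIMSEQ_subseq_LIMSEQ[OF lim mono] by (simp add: o_def)
    from uniform_limitD[OF dist_fun_limit_uniform[OF this K] e]
    obtain N where N: "\<And>n. n \<ge> N \<Longrightarrow> \<forall>x\<in>K. dist (dist_fun (z (r n)) x) (h x) < e"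
      by (auto simp: eventually_sequentially)
    have "\<forall>\<^sub>F s in at_top. s \<in> T \<longrightarrow> (\<forall>x\<in>K. dist (dist_fun (\<gamma> s) x) (h x) < e)"
      using eventually_ge_at_top[of "t N"]
    proof eventually_elim
      case (elim s)
      show ?case
      proof
        assume "s \<in> T"
        then obtain n where "s = t n" "N \<le> n" using late elim by blast
        then show "\<forall>x\<in>K. dist (dist_fun (\<gamma> s) x) (h x) < e" using N \<gamma>t by simp
      qed
    qed
    then show "\<forall>\<^sub>F s in inf at_top (principal T). \<forall>x\<in>K. dist (dist_fun (\<gamma> s) x) (h x) < e"
      by (simp add: eventually_inf_principal)
  qed
  ultimately show ?thesis using h unfolding busemann_point_def by blast
qed

section \<open>Linear embeddings and Painleve-Kuratowski limits\<close>

lemma tendsto_if_image_tendsto: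
  fixes J :: "'w::real_normed_vector \<Rightarrow> 'v::real_normed_vector"
  assumes J: "bounded_linear J" "m > 0" "\<And>y. m * norm y \<le> norm (J y)"
    and lim: "(\<lambda>n. J (X n)) \<longlonglongrightarrow> J x"
  shows "X \<longlonglongrightarrow> x"
proof -
  interpret J: bounded_linear J by (rule J(1))
  have "(\<lambda>n. J (X n - x)) \<longlonglongrightarrow> 0"
    using lim by (simp add: J.diff LIM_zero_iff)
  then have "(\<lambda>n. norm (J (X n - x)) / m) \<longlonglongrightarrow> 0"
    using tendsto_divide[OF tendsto_norm_zero tendsto_const[of m]] J(2) by fastforce
  then have "(\<lambda>n. X n - x) \<longlonglongrightarrow> 0"
    by (rule Lim_null_comparison[rotated])
      (use J(2,3) in \<open>auto simp: pos_le_divide_eq mult.commute\<close>)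
  then show ?thesis by (simp add: LIM_zero_iff)
qed

lemma closed_image_bounded_below:
  fixes J :: "'w::real_normed_vector \<Rightarrow> 'v::real_normed_vector"
  assumes J: "bounded_linear J" "m > 0" "\<And>y. m * norm y \<le> norm (J y)"
    and B: "closed (J ` B)" and S: "closed S" "S \<subseteq> B"
  shows "closed (J ` S)"
proof -
  have "l \<in> J ` S" if "\<forall>n. Y n \<in> J ` S" "Y \<longlonglongrightarrow> l" for Y l
  proof -
    have "l \<in> J ` B" using closed_sequentially[OF B, of Y l] that S(2) by blast
    then obtain x where x: "x \<in> B" "l = J x" by blast
    have "\<forall>n. \<exists>c\<in>S. Y n = J c" using that(1) by blast
    then obtain c where c: "\<And>n. c n \<in> S" "\<And>n. Y n = J (c n)" by metis
    have "c \<longlonglongrightarrow> x"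
    proof (rule tendsto_if_image_tendsto[OF J])
      have "Y = (\<lambda>n. J (c n))" by (rule ext) (rule c(2))
      then show "(\<lambda>n. J (c n)) \<longlonglongrightarrow> J x" using that(2) x(2) by simp
    qed
    then have "x \<in> S" using closed_sequentially[OF S(1)] c(1) by blast
    then show ?thesis using x(2) by blast
  qed
  then show ?thesis unfolding closed_sequential_limits by blast
qed

lemma PK_converges_image:
  fixes J :: "'w::real_normed_vector \<Rightarrow> 'v::real_normed_vector"
  assumes J: "bounded_linear J" "m > 0" "\<And>y. m * norm y \<le> norm (J y)" and inj: "inj J"
    and B: "closed (J ` B)" and F: "\<And>n. F n \<subseteq> B"
  shows "PK_converges (\<lambda>n. J ` F n) (J ` C) \<longleftrightarrow> PK_converges F C"
proof
  have fwd: "(\<lambda>n. J (X n)) \<longlonglongrightarrow> J x" if "X \<longlonglongrightarrow> x" for X x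
    using J(1) that by (rule bounded_linear.tendsto)
  have inv: "J (inv J w) = w" if "w \<in> J ` S" for w S using that inj by auto
  have memi: "inv J w \<in> S" if "w \<in> J ` S" for w S using that inj by auto
  {
    assume PK: "PK_converges (\<lambda>n. J ` F n) (J ` C)"
    show "PK_converges F C"
      unfolding PK_converges_def
    proof (intro conjI ballI allI impI)
      fix x assume "x \<in> C"
      then have "J x \<in> J ` C" by blast
      with PK obtain Y where Y: "\<forall>\<^sub>F n in sequentially. Y n \<in> J ` F n" "Y \<longlonglongrightarrow> J x"
        by (rule PK_limit_approx)
      have "(\<lambda>n. J (inv J (Y n))) \<longlonglongrightarrow> J x"
      proof (rule Lim_transform_eventually[OF Y(2)])
        show "\<forall>\<^sub>F n in sequentially. Y n = J (inv J (Y n))"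
          using Y(1) by (rule eventually_mono) (rule inv[symmetric])
      qed
      then have "(\<lambda>n. inv J (Y n)) \<longlonglongrightarrow> x" by (rule tendsto_if_image_tendsto[OF J])
      moreover have "\<forall>\<^sub>F n in sequentially. inv J (Y n) \<in> F n"
        using Y(1) memi by (auto elim!: eventually_mono)
      ultimately show "\<exists>X. (\<forall>\<^sub>F n in sequentially. X n \<in> F n) \<and> X \<longlonglongrightarrow> x"
        by (intro exI[of _ "\<lambda>n. inv J (Y n)"] conjI)
    next
      fix r :: "nat \<Rightarrow> nat" and X x
      assume *: "strict_mono r \<and> (\<forall>k. X k \<in> F (r k)) \<and> X \<longlonglongrightarrow> x"
      then have "J x \<in> J ` C"
        by (intro PK_limit_subseq_mem[OF PK, of r "\<lambda>k. J (X k)"] fwd) auto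
      then show "x \<in> C" using inj by (simp add: inj_image_mem_iff)
    qed
  }
  {
    assume PK: "PK_converges F C"
    show "PK_converges (\<lambda>n. J ` F n) (J ` C)"
      unfolding PK_converges_def
    proof (intro conjI ballI allI impI)
      fix w assume "w \<in> J ` C"
      then obtain x where x: "x \<in> C" "w = J x" by blast
      obtain X where X: "\<forall>\<^sub>F n in sequentially. X n \<in> F n" "X \<longlonglongrightarrow> x"
        using PK x(1) by (rule PK_limit_approx)
      have "\<forall>\<^sub>F n in sequentially. J (X n) \<in> J ` F n" using X(1) by (rule eventually_mono) blast
      then show "\<exists>X. (\<forall>\<^sub>F n in sequentially. X n \<in> J ` F n) \<and> X \<longlonglongrightarrow> w"
        using fwd[OF X(2)] x(2) by (intro exI[of _ "\<lambda>n. J (X n)"] conjI) simp_all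
    next
      fix r :: "nat \<Rightarrow> nat" and Y w
      assume *: "strict_mono r \<and> (\<forall>k. Y k \<in> J ` F (r k)) \<and> Y \<longlonglongrightarrow> w"
      then have "\<forall>k. Y k \<in> J ` B" using F by blast
      then have "w \<in> J ` B" using closed_sequentially[OF B] * by blast
      then obtain x where x: "w = J x" by blast
      have "(\<lambda>k. J (inv J (Y k))) \<longlonglongrightarrow> J x"
        using * x inv by (metis (no_types, lifting) ext)
      then have "(\<lambda>k. inv J (Y k)) \<longlonglongrightarrow> x" by (rule tendsto_if_image_tendsto[OF J])
      moreover have "inv J (Y k) \<in> F (r k)" for k using * memi by blast
      moreover have "strict_mono r" using * by blast
      ultimately have "x \<in> C" using PK_limit_subseq_mem[OF PK, of r "\<lambda>k. inv J (Y k)"] by simp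
      then show "w \<in> J ` C" using x by blast
    qed
  }
qed

lemma PK_closed_extreme_sets_image:
  fixes J :: "'w::real_normed_vector \<Rightarrow> 'v::real_normed_vector"
  assumes J: "bounded_linear J" "m > 0" "\<And>y. m * norm y \<le> norm (J y)"
    and B: "closed (J ` B)"
  shows "PK_closed (extreme_sets (J ` B)) \<longleftrightarrow> PK_closed (extreme_sets B)"
proof -
  interpret J: bounded_linear J by (rule J(1))
  have inj: "inj J"
  proof (rule injI)
    fix x y assume "J x = J y"
    then have "m * norm (x - y) \<le> 0" using J(3)[of "x - y"] by (simp add: J.diff)
    then show "x = y" using J(2) by (simp add: mult_le_0_iff)
  qed
  have cont: "continuous_on UNIV J" by (rule linear_continuous_on[OF J(1)])
  have vimage: "closed (J -` S)" if "closed S" for S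
    using that cont continuous_on_closed_vimage[of UNIV J] by auto
  have clB: "closed B"
    using vimage[OF B] inj by (simp add: inj_vimage_image_eq)
  have mem: "J ` E \<in> extreme_sets (J ` B) \<longleftrightarrow> E \<in> extreme_sets B" for E
    by (simp add: extreme_sets_def face_of_linear_image[OF J.linear_axioms inj])
  have sub: "E \<subseteq> B" if "E \<in> extreme_sets B" for E
    using that face_of_imp_subset by (auto simp: extreme_sets_def)
  have pre: "\<exists>E. S = J ` E \<and> E \<in> extreme_sets B" if "S \<in> extreme_sets (J ` B)" for S
  proof -
    have "S \<subseteq> J ` B" using that face_of_imp_subset by (auto simp: extreme_sets_def)
    then obtain E where "S = J ` E" by (meson subset_imageE)
    then show ?thesis using that mem by blast
  qed
  have PK: "PK_converges (\<lambda>n. J ` F n) (J ` C) \<longleftrightarrow> PK_converges F C"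
    if "\<And>n. F n \<in> extreme_sets B" for F C
    by (rule PK_converges_image[OF J inj B sub[OF that]])
  have cl_image: "closed (J ` S)" if "closed S" "S \<subseteq> B" for S
    by (rule closed_image_bounded_below[OF J B that])
  show ?thesis
  proof
    assume D: "PK_closed (extreme_sets (J ` B))"
    show "PK_closed (extreme_sets B)"
      unfolding PK_closed_def
    proof (intro conjI subsetI allI impI)
      fix E assume "E \<in> extreme_sets B"
      then have "closed (J ` E)" using conjunct1[OF D[unfolded PK_closed_def]] mem by blast
      then show "E \<in> Collect closed"
        using vimage[of "J ` E"] inj by (simp add: inj_vimage_image_eq)
    next
      fix F C assume *: "(\<forall>n. F n \<in> extreme_sets B) \<and> closed C \<and> PK_converges F C"
      then have F: "\<And>n. F n \<in> extreme_sets B" and C: "closed C" "PK_converges F C" by auto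
      have "C \<subseteq> B" using PK_limit_subset[OF C(2) sub[OF F] clB] .
      then have clJ: "closed (J ` C)" by (rule cl_image[OF C(1)])
      have PKJ: "PK_converges (\<lambda>n. J ` F n) (J ` C)" using C(2) by (simp only: PK[OF F])
      have "J ` C \<in> extreme_sets (J ` B)"
        by (rule PK_closedD[OF D _ clJ PKJ]) (simp only: mem F)
      then show "C \<in> extreme_sets B" by (simp add: mem)
    qed
  next
    assume D: "PK_closed (extreme_sets B)"
    show "PK_closed (extreme_sets (J ` B))"
      unfolding PK_closed_def
    proof (intro conjI subsetI allI impI)
      fix S assume "S \<in> extreme_sets (J ` B)"
      then obtain E where E: "S = J ` E" "E \<in> extreme_sets B" using pre by blast
      then have "closed E" using conjunct1[OF D[unfolded PK_closed_def]] by blast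
      then show "S \<in> Collect closed" using cl_image E sub by simp
    next
      fix G C assume *: "(\<forall>n. G n \<in> extreme_sets (J ` B)) \<and> closed C \<and> PK_converges G C"
      have "\<exists>E. G n = J ` E \<and> E \<in> extreme_sets B" for n using pre * by simp
      then obtain F where F: "\<And>n. G n = J ` F n" "\<And>n. F n \<in> extreme_sets B" by metis
      have GB: "G n \<subseteq> J ` B" for n using F(1)[of n] sub[OF F(2)[of n]] by blast
      have "PK_converges G C" using * by simp
      then have "C \<subseteq> J ` B" using GB B by (rule PK_limit_subset)
      then have C: "C = J ` (J -` C)" by blast
      have "closed (J -` C)" using * vimage by blast
      moreover have "PK_converges F (J -` C)"
      proof -
        have G: "G = (\<lambda>n. J ` F n)" by (rule ext) (rule F(1))
        have "PK_converges (\<lambda>n. J ` F n) (J ` (J -` C))"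
          using * by (simp only: G[symmetric] C[symmetric])
        then show ?thesis by (simp only: PK[OF F(2)])
      qed
      ultimately have "J -` C \<in> extreme_sets B" by (rule PK_closedD[OF D F(2)])
      then show "C \<in> extreme_sets (J ` B)" using C mem by metis
    qed
  qed
qed

section \<open>Coordinates on a finite-dimensional space\<close>

text \<open>A finite spanning set of a finite-dimensional space \<open>'a\<close>, made into a type of its own below, so that
  \<open>real ^ 'a coord_index\<close> is a Euclidean space that maps linearly onto \<open>'a\<close>. The vector \<open>0\<close> is
  added to the type because a type must have an element; it contributes nothing to linear combinations.
  In infinite dimension the set is empty, so that the type is finite for every \<open>'a\<close>.\<close>
definition spanning_set :: "'a::real_normed_vector set" where
  "spanning_set = (if \<exists>S :: 'a set. finite S \<and> span S = UNIV
     then SOME S. finite S \<and> span S = UNIV else {})"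

lemma spanning_set:
  assumes "\<exists>S :: 'a::real_normed_vector set. finite S \<and> span S = UNIV"
  shows "finite (spanning_set :: 'a set) \<and> span (spanning_set :: 'a set) = UNIV"
  using someI_ex[OF assms] assms by (simp add: spanning_set_def)

lemma finite_spanning_set: "finite (spanning_set :: 'a::real_normed_vector set)"
proof (cases "\<exists>S :: 'a set. finite S \<and> span S = UNIV")
  case True
  then show ?thesis using spanning_set by blast
next
  case False
  then show ?thesis unfolding spanning_set_def by (subst if_not_P) auto
qed

typedef (overloaded) 'a coord_index = "insert 0 (spanning_set :: 'a::real_normed_vector set)"
  by blast

instance coord_index :: (real_normed_vector) finite
proof
  have "(UNIV :: 'a coord_index set) = Abs_coord_index ` insert 0 spanning_set"
    by (rule type_definition.Abs_image[OF type_definition_coord_index, symmetric])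
  then show "finite (UNIV :: 'a coord_index set)"
    using finite_spanning_set by (metis finite_imageI finite_insert)
qed

definition combination :: "real ^ 'a coord_index \<Rightarrow> 'a::real_normed_vector" where
  "combination v = (\<Sum>i\<in>UNIV. (v $ i) *\<^sub>R Rep_coord_index i)"

definition dual_coords :: "('a::real_normed_vector \<Rightarrow>\<^sub>L real) \<Rightarrow> real ^ 'a coord_index" where
  "dual_coords y = (\<chi> i. blinfun_apply y (Rep_coord_index i))"

lemma linear_combination: "linear combination"
  unfolding combination_def
  by (rule linearI) (simp_all add: sum.distrib scaleR_add_left scaleR_sum_right)

lemma bounded_linear_combination: "bounded_linear combination"
  using linear_combination by (simp add: linear_conv_bounded_linear)

lemma inner_dual_coords: "dual_coords y \<bullet> v = blinfun_apply y (combination v)"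
  by (simp add: dual_coords_def combination_def inner_vec_def blinfun.sum_right
      blinfun.scaleR_right mult.commute)

lemma bounded_linear_dual_coords:
  "bounded_linear (dual_coords :: ('a::real_normed_vector \<Rightarrow>\<^sub>L real) \<Rightarrow> _)"
proof (rule bounded_linear_intro)
  fix y :: "'a \<Rightarrow>\<^sub>L real"
  have "norm (dual_coords y) \<le> (\<Sum>i\<in>UNIV. \<bar>dual_coords y $ i\<bar>)" by (rule norm_le_l1_cart)
  also have "\<dots> \<le> (\<Sum>i\<in>UNIV. norm y * norm (Rep_coord_index i :: 'a))"
    using norm_blinfun[of y] by (intro sum_mono) (simp add: dual_coords_def)
  finally show "norm (dual_coords y) \<le> norm y * (\<Sum>i\<in>UNIV. norm (Rep_coord_index i :: 'a))"
    by (simp add: sum_distrib_left)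
qed (simp_all add: dual_coords_def vec_eq_iff blinfun.add_left blinfun.scaleR_left)

lemma surj_combination:
  assumes "\<exists>S :: 'a::real_normed_vector set. finite S \<and> span S = UNIV"
  shows "\<exists>v. combination v = (x :: 'a)"
proof -
  have "x \<in> span spanning_set" using spanning_set[OF assms] by simp
  then obtain u where u: "x = (\<Sum>b\<in>spanning_set. u b *\<^sub>R b)"
    using span_finite[OF finite_spanning_set] by auto
  have bij: "bij_betw Rep_coord_index UNIV (insert 0 spanning_set :: 'a set)"
    using type_definition.Rep_range[OF type_definition_coord_index]
    by (auto simp: bij_betw_def inj_on_def Rep_coord_index_inject)
  have "combination (\<chi> i. u (Rep_coord_index i)) = (\<Sum>b\<in>insert 0 spanning_set. u b *\<^sub>R b)"
    unfolding combination_def using sum.reindex_bij_betw[OF bij, of "\<lambda>b. u b *\<^sub>R b"] by simp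
  also have "\<dots> = x"
    unfolding u using finite_spanning_set[where 'a='a] by (cases "0 \<in> (spanning_set :: 'a set)") (auto simp: insert_absorb)
  finally show ?thesis by blast
qed

text \<open>Equivalence of norms: \<open>norm \<circ> combination\<close> is positive on the unit sphere of the orthogonal
  complement of the kernel of \<open>combination\<close>, which is compact.\<close>
lemma bounded_preimage_combination:
  assumes fin: "\<exists>S :: 'a::real_normed_vector set. finite S \<and> span S = UNIV"
  obtains m where "m > 0" "\<And>x :: 'a. \<exists>v. combination v = x \<and> m * norm v \<le> norm x"
proof -
  interpret c: bounded_linear "combination :: _ \<Rightarrow> 'a" by (rule bounded_linear_combination)
  define K where "K = {v. combination v = (0 :: 'a)}"
  define S where "S = sphere 0 1 \<inter> orthogonal_comp K"
  have K: "subspace K"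
    unfolding K_def by (rule subspaceI) (simp_all add: c.add c.scaleR c.zero)
  have "compact S"
    unfolding S_def using closed_subspace[OF subspace_orthogonal_comp]
    by (intro compact_Int_closed) auto
  have pos: "combination v \<noteq> (0 :: 'a)" if "v \<in> S" for v
  proof
    assume "combination v = (0 :: 'a)"
    then have "v \<in> K" by (simp add: K_def)
    then have "v = 0" using that by (auto simp: S_def orthogonal_comp_def orthogonal_self)
    then show False using that by (simp add: S_def)
  qed
  obtain m where m: "m > 0" "\<And>v. v \<in> S \<Longrightarrow> m \<le> norm (combination v :: 'a)"
  proof (cases "S = {}")
    case True
    then show thesis using that[of 1] by simp
  next
    case False
    have "continuous_on S (\<lambda>v. norm (combination v :: 'a))"
      by (intro continuous_on_norm linear_continuous_on bounded_linear_combination)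
    from continuous_attains_inf[OF \<open>compact S\<close> False this]
    obtain v where "v \<in> S" "\<And>u. u \<in> S \<Longrightarrow> norm (combination v :: 'a) \<le> norm (combination u :: 'a)"
      by blast
    then show thesis using pos[of v] by (intro that[of "norm (combination v :: 'a)"]) auto
  qed
  have "\<exists>v. combination v = x \<and> m * norm v \<le> norm x" for x :: 'a
  proof -
    obtain u where u: "combination u = x" using surj_combination[OF fin] by blast
    obtain k w where kw: "k \<in> span K" "\<And>v. v \<in> span K \<Longrightarrow> orthogonal w v" "u = k + w"
      using orthogonal_subspace_decomp_exists[of K u] by metis
    have "k \<in> K" using kw(1) K by (metis span_eq_iff)
    then have x: "combination w = x"
      using u kw(3) by (simp add: c.add K_def)
    have "m * norm w \<le> norm x"
    proof (cases "w = 0")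
      case False
      have "w \<in> orthogonal_comp K"
        using kw(2) span_base by (auto simp: orthogonal_comp_def orthogonal_commute)
      then have "(1 / norm w) *\<^sub>R w \<in> S"
        using False subspace_scale[OF subspace_orthogonal_comp] by (simp add: S_def)
      from m(2)[OF this] show ?thesis
        using False x by (simp add: c.scaleR pos_le_divide_eq)
    qed simp
    then show ?thesis using x by blast
  qed
  with m(1) that show thesis by blast
qed

section \<open>The dual unit ball in coordinates\<close>

definition dual_ball_coords :: "'a itself \<Rightarrow> (real ^ 'a::real_normed_vector coord_index) set" where
  "dual_ball_coords _ = dual_coords ` (dual_unit_ball :: ('a \<Rightarrow>\<^sub>L real) set)"

text \<open>Together with the boundedness of \<open>dual_coords\<close> this says that the operator norm and the
  Euclidean norm of the coordinates induce the same limits of functionals.\<close>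
lemma norm_le_dual_coords:
  assumes m: "\<And>x :: 'a::real_normed_vector. \<exists>v. combination v = x \<and> m * norm v \<le> norm x" "m > 0"
  shows "m * norm y \<le> norm (dual_coords (y :: 'a \<Rightarrow>\<^sub>L real))"
proof -
  have "norm y \<le> norm (dual_coords y) / m"
  proof (rule norm_blinfun_bound)
    fix x :: 'a
    obtain v where v: "combination v = x" "m * norm v \<le> norm x" using m(1)[of x] by blast
    have "norm (blinfun_apply y x) \<le> norm (dual_coords y) * norm v"
      using Cauchy_Schwarz_ineq2[of "dual_coords y" v] by (simp add: inner_dual_coords v(1))
    also have "\<dots> \<le> norm (dual_coords y) * (norm x / m)"
      using v(2) m(2) by (intro mult_left_mono) (simp_all add: pos_le_divide_eq mult.commute)
    finally show "norm (blinfun_apply y x) \<le> norm (dual_coords y) / m * norm x" by simp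
  qed (use m(2) in simp)
  then show ?thesis using m(2) by (simp add: pos_le_divide_eq mult.commute)
qed

text \<open>An element of the right-hand side vanishes on the kernel of \<open>combination\<close>, being bounded
  below on it, so it defines a functional on \<open>'a\<close>.\<close>
lemma dual_ball_coords_eq:
  assumes fin: "\<exists>S :: 'a::real_normed_vector set. finite S \<and> span S = UNIV"
  shows "dual_ball_coords TYPE('a) = {w. \<forall>v. norm (combination v :: 'a) \<le> 1 \<longrightarrow> -1 \<le> w \<bullet> v}"
proof (intro equalityI subsetI)
  fix w assume "w \<in> dual_ball_coords TYPE('a)"
  then show "w \<in> {w. \<forall>v. norm (combination v :: 'a) \<le> 1 \<longrightarrow> -1 \<le> w \<bullet> v}"
    by (auto simp: dual_ball_coords_def dual_unit_ball_def inner_dual_coords)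
next
  interpret c: bounded_linear "combination :: _ \<Rightarrow> 'a" by (rule bounded_linear_combination)
  fix w assume "w \<in> {w. \<forall>v. norm (combination v :: 'a) \<le> 1 \<longrightarrow> -1 \<le> w \<bullet> v}"
  then have w: "-1 \<le> w \<bullet> v" if "norm (combination v :: 'a) \<le> 1" for v using that by blast
  have ker: "w \<bullet> v = 0" if v: "combination v = (0 :: 'a)" for v
  proof (rule ccontr)
    assume nz: "w \<bullet> v \<noteq> 0"
    have "-1 \<le> w \<bullet> ((- 2 / (w \<bullet> v)) *\<^sub>R v)" by (rule w) (simp add: c.scaleR c.neg v)
    then show False using nz by simp
  qed
  obtain m where m: "m > 0" "\<And>x :: 'a. \<exists>v. combination v = x \<and> m * norm v \<le> norm x"
    using bounded_preimage_combination[OF fin] by metis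
  then obtain s where s: "\<And>x :: 'a. combination (s x) = x" "\<And>x. m * norm (s x) \<le> norm x"
    by metis
  have dep: "w \<bullet> v = w \<bullet> s (combination v)" for v
    using ker[of "v - s (combination v)"] by (simp add: c.diff s(1) inner_diff_right)
  have "bounded_linear (\<lambda>x. w \<bullet> s x)"
  proof (rule bounded_linear_intro)
    fix x y and r :: real
    show "w \<bullet> s (x + y) = w \<bullet> s x + w \<bullet> s y"
      using dep[of "s x + s y"] by (simp add: c.add s(1) inner_add_right)
    show "w \<bullet> s (r *\<^sub>R x) = r *\<^sub>R (w \<bullet> s x)"
      using dep[of "r *\<^sub>R s x"] by (simp add: c.scaleR s(1))
    have "norm (w \<bullet> s x) \<le> norm w * norm (s x)"
      using Cauchy_Schwarz_ineq2[of w "s x"] by simp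
    also have "\<dots> \<le> norm w * (norm x / m)"
      using s(2) m(1) by (intro mult_left_mono) (simp_all add: pos_le_divide_eq mult.commute)
    finally show "norm (w \<bullet> s x) \<le> norm x * (norm w / m)" by (simp add: mult.commute)
  qed
  then have y: "blinfun_apply (Blinfun (\<lambda>x. w \<bullet> s x)) x = w \<bullet> s x" for x
    by (simp add: bounded_linear_Blinfun_apply)
  have "dual_coords (Blinfun (\<lambda>x. w \<bullet> s x)) \<bullet> v = w \<bullet> v" for v
    using dep[of v] by (simp add: inner_dual_coords y)
  then have "dual_coords (Blinfun (\<lambda>x. w \<bullet> s x)) = w"
    by (metis vector_eq_rdot)
  moreover have "Blinfun (\<lambda>x. w \<bullet> s x) \<in> dual_unit_ball"
    using w s(1) by (auto simp: dual_unit_ball_def y)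
  ultimately show "w \<in> dual_ball_coords TYPE('a)"
    unfolding dual_ball_coords_def by (metis imageI)
qed

lemma dual_ball_coords_compact_convex:
  assumes fin: "\<exists>S :: 'a::real_normed_vector set. finite S \<and> span S = UNIV"
  shows "compact (dual_ball_coords TYPE('a))" "convex (dual_ball_coords TYPE('a))"
    "0 \<in> dual_ball_coords TYPE('a)"
proof -
  interpret c: bounded_linear "combination :: _ \<Rightarrow> 'a" by (rule bounded_linear_combination)
  define D where "D = dual_ball_coords TYPE('a)"
  have D: "D = {w. \<forall>v. norm (combination v :: 'a) \<le> 1 \<longrightarrow> -1 \<le> w \<bullet> v}"
    unfolding D_def by (rule dual_ball_coords_eq[OF fin])
  then have Int: "D = (\<Inter>v\<in>{v. norm (combination v :: 'a) \<le> 1}. {w. -1 \<le> w \<bullet> v})" by auto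
  have half: "{w. -1 \<le> w \<bullet> v} = {w. v \<bullet> w \<ge> -1}" for v :: "real ^ 'a coord_index"
    by (simp add: inner_commute)
  have "closed D"
    unfolding Int half by (intro closed_INT ballI closed_halfspace_ge)
  moreover have "convex D"
    unfolding Int half by (intro convex_INT convex_halfspace_ge)
  moreover obtain k where k: "k > 0" "\<And>v. norm (combination v :: 'a) \<le> norm v * k"
    using c.pos_bounded by blast
  have "norm w \<le> k" if "w \<in> D" for w
  proof (cases "w = 0")
    case False
    define v where "v = (- 1 / (k * norm w)) *\<^sub>R w"
    have "norm (combination v :: 'a) \<le> 1"
      using k(2)[of v] False k(1) by (simp add: v_def)
    then have "-1 \<le> w \<bullet> v" using that by (simp add: D)
    also have "w \<bullet> v = - (norm w / k)"
      using False by (simp add: v_def power2_norm_eq_inner[symmetric] power2_eq_square)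
    finally show ?thesis using k(1) by (simp add: divide_le_eq)
  qed (use k(1) in simp)
  then have "bounded D" unfolding bounded_iff by blast
  moreover have "0 \<in> D" by (simp add: D)
  ultimately show "compact (dual_ball_coords TYPE('a))" "convex (dual_ball_coords TYPE('a))"
    "0 \<in> dual_ball_coords TYPE('a)"
    by (auto simp: compact_eq_bounded_closed D_def)
qed

text \<open>This form of the Hahn-Banach theorem follows from separation in coordinates. If the norm of
  \<open>combination v\<close> exceeded the support function, a scaled-down copy of \<open>v\<close> outside the unit ball could be
  separated from the ball by an element of the dual unit ball at which \<open>v\<close> exceeds the support function.\<close>
lemma support_fun_dual_ball_coords:
  assumes fin: "\<exists>S :: 'a::real_normed_vector set. finite S \<and> span S = UNIV"
  shows "support_fun (dual_ball_coords TYPE('a)) v = norm (combination v :: 'a)"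
proof -
  interpret c: bounded_linear "combination :: _ \<Rightarrow> 'a" by (rule bounded_linear_combination)
  define D where "D = dual_ball_coords TYPE('a)"
  have cmp: "compact D" "0 \<in> D" using dual_ball_coords_compact_convex[OF fin] by (auto simp: D_def)
  have D: "D = {w. \<forall>v. norm (combination v :: 'a) \<le> 1 \<longrightarrow> -1 \<le> w \<bullet> v}"
    unfolding D_def by (rule dual_ball_coords_eq[OF fin])
  have "support_fun D v \<le> norm (combination v :: 'a)"
  proof (rule support_fun_le[OF cmp(1)])
    fix w assume w: "w \<in> D"
    show "w \<bullet> v \<le> norm (combination v :: 'a)"
    proof (rule field_le_epsilon)
      fix e :: real assume e: "e > 0"
      define t where "t = norm (combination v :: 'a) + e"
      have t: "t > 0" using e by (simp add: t_def add_nonneg_pos)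
      have "norm (combination ((- 1 / t) *\<^sub>R v) :: 'a) \<le> 1"
        using t e by (simp add: c.scaleR t_def c.neg)
      then have "-1 \<le> w \<bullet> ((- 1 / t) *\<^sub>R v)" using w unfolding D by blast
      then have "w \<bullet> v / t \<le> 1" by simp
      then show "w \<bullet> v \<le> norm (combination v :: 'a) + e"
        using t by (simp add: t_def divide_le_eq)
    qed
  qed (use cmp in blast)
  moreover have "norm (combination v :: 'a) \<le> support_fun D v"
  proof (rule ccontr)
    assume "\<not> ?thesis"
    then obtain r where r: "support_fun D v < r" "r < norm (combination v :: 'a)"
      using dense by (metis not_le)
    have "0 \<le> support_fun D v" using support_fun_upper[OF cmp, of v] by simp
    then have r0: "r > 0" using r(1) by linarith
    define P where "P = {u. norm (combination u :: 'a) \<le> 1}"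
    have "closed P"
      unfolding P_def by (intro closed_Collect_le continuous_on_norm linear_continuous_on
          bounded_linear_combination continuous_on_const)
    moreover have "convex P"
    proof -
      have "P = combination -` (cball 0 1 :: 'a set)" by (auto simp: P_def)
      then show ?thesis using convex_linear_vimage[OF linear_combination, of "cball 0 1"] by simp
    qed
    moreover have "(1 / r) *\<^sub>R v \<notin> P" using r(2) r0 by (simp add: P_def c.scaleR)
    ultimately obtain a b where a: "a \<bullet> ((1 / r) *\<^sub>R v) < b" "\<And>u. u \<in> P \<Longrightarrow> b < a \<bullet> u"
      using separating_hyperplane_closed_point[of P "(1 / r) *\<^sub>R v"] by blast
    have "0 \<in> P" by (simp add: P_def c.zero)
    then have b: "b < 0" using a(2) by fastforce
    define w where "w = (1 / b) *\<^sub>R a"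
    have wu: "w \<bullet> u \<le> 1" if "u \<in> P" for u
      using a(2)[OF that] b by (simp add: w_def divide_le_eq)
    have "w \<in> D"
      unfolding D
    proof (intro CollectI allI impI)
      fix u assume "norm (combination u :: 'a) \<le> 1"
      then have "- u \<in> P" by (simp add: P_def c.neg)
      from wu[OF this] show "-1 \<le> w \<bullet> u" by simp
    qed
    moreover have "w \<bullet> ((1 / r) *\<^sub>R v) = a \<bullet> ((1 / r) *\<^sub>R v) / b" by (simp add: w_def)
    then have "w \<bullet> ((1 / r) *\<^sub>R v) > 1" using a(1) neg_less_divide_eq[OF b] by (simp only: mult_1)
    then have "w \<bullet> v > r" using r0 by simp
    ultimately show False using support_fun_upper[OF cmp(1), of w v] r(1) by linarith
  qed
  ultimately show ?thesis by (simp add: D_def)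
qed

section \<open>Busemann points and the closedness of the set of extreme sets\<close>

theorem theorem1p2:
  assumes "\<exists>S :: 'a::real_normed_vector set. finite S \<and> span S = UNIV"
  shows "(\<forall>h \<in> (horofunction_boundary :: ('a \<Rightarrow> real) set). busemann_point h) \<longleftrightarrow>
    PK_closed (extreme_sets (dual_unit_ball :: ('a \<Rightarrow>\<^sub>L real) set))"
proof -
  note fin = assms
  interpret c: bounded_linear "combination :: _ \<Rightarrow> 'a" by (rule bounded_linear_combination)
  define D where "D = dual_ball_coords TYPE('a)"
  have D: "compact D" "convex D" "D \<noteq> {}"
    using dual_ball_coords_compact_convex[OF fin] by (auto simp: D_def)
  have \<sigma>: "support_fun D v = norm (combination v :: 'a)" for v
    unfolding D_def by (rule support_fun_dual_ball_coords[OF fin])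
  have \<phi>: "support_dist_fun D u v = dist_fun (combination u :: 'a) (combination v)" for u v
    by (simp add: support_dist_fun_def \<sigma> dist_fun_def c.diff c.neg norm_minus_commute)
  obtain m where m: "m > 0" "\<And>x :: 'a. \<exists>v. combination v = x \<and> m * norm v \<le> norm x"
    using bounded_preimage_combination[OF fin] by metis
  then obtain s where s: "\<And>x :: 'a. combination (s x) = x" "\<And>x. m * norm (s x) \<le> norm x"
    by metis
  have "PK_closed (extreme_sets D) \<longleftrightarrow> PK_closed (extreme_sets (dual_unit_ball :: ('a \<Rightarrow>\<^sub>L real) set))"
    unfolding D_def dual_ball_coords_def
    by (rule PK_closed_extreme_sets_image[OF bounded_linear_dual_coords m(1) norm_le_dual_coords[OF m(2,1)]])
      (use compact_imp_closed[OF D(1)] in \<open>simp add: D_def dual_ball_coords_def\<close>)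
  moreover have "PK_closed (extreme_sets D) \<longleftrightarrow>
    (\<forall>h \<in> (horofunction_boundary :: ('a \<Rightarrow> real) set). busemann_point h)"
  proof
    assume cl: "PK_closed (extreme_sets D)"
    show "\<forall>h \<in> (horofunction_boundary :: ('a \<Rightarrow> real) set). busemann_point h"
    proof
      fix h :: "'a \<Rightarrow> real" assume h: "h \<in> horofunction_boundary"
      then have "h \<in> ucc_topology closure_of range dist_fun" by (simp add: horofunction_boundary_def)
      then obtain z where z: "\<And>x. (\<lambda>n. dist_fun (z n) x) \<longlonglongrightarrow> h x"
      proof (rule dist_fun_limit_if_in_closure)
        show "compact (combination ` cball 0 (real n) :: 'a set)" for n
          by (intro compact_continuous_image linear_continuous_on bounded_linear_combination compact_cball)
        show "\<exists>N. \<forall>n\<ge>N. x \<in> combination ` cball 0 (real n)" for x :: 'a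
        proof -
          obtain N :: nat where "norm (s x) \<le> real N" using real_arch_simple by blast
          then show ?thesis
            using s(1)[of x] by (intro exI[of _ N] allI impI image_eqI[of _ _ "s x"]) auto
        qed
      qed (rule that)
      have "(\<lambda>n. support_dist_fun D (s (z n)) v) \<longlonglongrightarrow> h (combination v)" for v
        unfolding \<phi> s(1) by (rule z)
      then obtain u where u: "\<And>v. (\<lambda>n. support_dist_fun D (u n) v) \<longlonglongrightarrow> h (combination v)"
          "(\<lambda>n. h (combination (u n)) + support_fun D (- u n)) \<longlonglongrightarrow> 0"
        by (rule limits_of_support_dist_funs_if_faces_closed[OF D cl]) (rule that)
      have lim: "(\<lambda>n. dist_fun (combination (u n)) x) \<longlonglongrightarrow> h x" for x
        using u(1)[of "s x"] by (simp add: \<phi> s(1))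
      \<comment> \<open>Otherwise a subsequence of the points would converge, and \<open>h\<close> would be the distance function of its limit.\<close>
      have far: "filterlim (\<lambda>n. norm (combination (u n) :: 'a)) at_top sequentially"
        unfolding filterlim_at_top
      proof (rule allI, rule ccontr)
        fix R assume "\<not> (\<forall>\<^sub>F n in sequentially. R \<le> norm (combination (u n) :: 'a))"
        then have "\<exists>\<^sub>F n in sequentially. norm (combination (u n) :: 'a) < R"
          by (simp add: not_eventually not_le)
        then obtain r where r: "strict_mono (r :: nat \<Rightarrow> nat)" "\<And>k. norm (combination (u (r k)) :: 'a) < R"
          by (rule frequently_sequentially_subseq[where P="\<lambda>_ n. norm (combination (u n) :: 'a) < R"])
            (rule that)
        define g where "g k = s (combination (u (r k)))" for k
        have "g k \<in> cball 0 (R / m)" for k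
          unfolding g_def using s(2)[of "combination (u (r k))"] r(2)[of k] m(1)
          by (simp add: pos_le_divide_eq mult.commute)
        then have "\<forall>k. g k \<in> cball 0 (R / m)" by blast
        then obtain l q where q: "strict_mono (q :: nat \<Rightarrow> nat)" "(g \<circ> q) \<longlonglongrightarrow> l"
          using compact_cball[of "0 :: real ^ 'a coord_index" "R / m"] unfolding compact_def by blast
        from c.tendsto[OF q(2)]
        have w: "(\<lambda>k. combination (u (r (q k))) :: 'a) \<longlonglongrightarrow> combination l" by (simp add: o_def g_def s(1))
        have "h x = dist_fun (combination l) x" for x
        proof (rule LIMSEQ_unique)
          show "(\<lambda>k. dist_fun (combination (u (r (q k)))) x) \<longlonglongrightarrow> h x"
            using LIMSEQ_subseq_LIMSEQ[OF lim strict_mono_o[OF r(1) q(1)]] by (simp add: o_def)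
          show "(\<lambda>k. dist_fun (combination (u (r (q k)))) x) \<longlonglongrightarrow> dist_fun (combination l) x"
            unfolding dist_fun_def by (intro tendsto_intros w)
        qed
        then have "h = dist_fun (combination l)" by (rule ext)
        then show False using h by (simp add: horofunction_boundary_def)
      qed
      show "busemann_point h"
      proof (rule busemann_pointI[OF lim _ far h])
        show "(\<lambda>n. h (combination (u n)) + norm (combination (u n) :: 'a)) \<longlonglongrightarrow> 0"
          using u(2) by (simp add: \<sigma> c.neg)
      qed
    qed
  next
    assume bus: "\<forall>h \<in> (horofunction_boundary :: ('a \<Rightarrow> real) set). busemann_point h"
    show "PK_closed (extreme_sets D)"
    proof (rule faces_closed_if_limits_of_support_dist_funs[OF D])
      fix z and h :: "_ \<Rightarrow> real"
      assume lim: "\<And>x. (\<lambda>n. support_dist_fun D (z n) x) \<longlonglongrightarrow> h x"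
      \<comment> \<open>The functions \<open>support_dist_fun D (z n)\<close>, and hence \<open>h\<close>, factor through \<open>combination\<close>.\<close>
      define H where "H x = h (s x)" for x :: 'a
      have limH: "(\<lambda>n. dist_fun (combination (z n)) x) \<longlonglongrightarrow> H x" for x
        using lim[of "s x"] by (simp add: \<phi> s(1) H_def)
      have hH: "h v = H (combination v)" for v
        using LIMSEQ_unique[OF lim[of v]] limH[of "combination v"] by (simp add: \<phi>)
      have cl: "H \<in> ucc_topology closure_of range dist_fun"
        using limH by (rule dist_fun_limit_in_closure)
      obtain w K where w: "\<And>x. (\<lambda>n. dist_fun (w n) x) \<longlonglongrightarrow> H x" "\<And>n. H (w n) + norm (w n) \<le> K"
      proof (cases "H \<in> range dist_fun")
        case True
        then obtain p where p: "H = dist_fun p" by blast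
        show thesis by (rule that[of "\<lambda>_. p" 0]) (simp_all add: p dist_fun_def)
      next
        case False
        then have "busemann_point H" using cl bus by (simp add: horofunction_boundary_def)
        then show thesis by (rule busemann_point_bounded) (rule that)
      qed
      show "\<exists>z' K. (\<forall>x. (\<lambda>n. support_dist_fun D (z' n) x) \<longlonglongrightarrow> h x) \<and>
          (\<forall>n. h (z' n) + support_fun D (- z' n) \<le> K)"
        by (rule exI[of _ "\<lambda>n. s (w n)"], rule exI[of _ K])
          (simp add: \<phi> \<sigma> s(1) hH c.neg w)
    qed
  qed
  ultimately show ?thesis by simp
qed

end
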